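(* Let $q$ be an odd prime power, and let $g \in SU_n(q)$. Then $g$ is strongly real in $SU_n(q)$ if and only if $g$ is strongly real as an element of some embedded $SO^{\pm}_n(q)$ (that is, there is an embedded special orthogonal subgroup $H\le SU_n(q)$, of split or non-split type, such that $g\in H$ and $g$ is strongly real in $H$).
   Context: An element $g$ of a group $G$ is strongly real in $G$ if there is $h\in G$ with $hgh^{-1}=g^{-1}$ and $h^2=1$. $GU_n(q)$ is the finite unitary group: for an invertible Hermitian matrix $\eta$ over $\mathbb{F}_{q^2}$, it is the group of $g\in GL_n(\bar{\mathbb{F}}_q)$ fixed by $F_\eta(g)=\eta^{-1}({}^{\top}F(g)^{-1})\eta$, where $F((a_{ij}))=(a_{ij}^q)$; equivalently the isometry group of a non-degenerate Hermitian form on $V=\mathbb{F}_{q^2}^n$. $SU_n(q)$ is its subgroup of determinant $1$ elements. For $q$ odd, $O_n^{\pm}(q)$ is the subgroup of $GL_n(q)$ stabilizing a non-degenerate (split $+$ or non-split $-$) symmetric form on $\mathbb{F}_q^n$ (with $O_n^+(q)=O_n^-(q)$ for $n$ odd), and $SO_n^\pm(q)$ is its subgroup of determinant $1$ elements. An embedded orthogonal group in $GU_n(q)$ is obtained as follows: take an $\mathbb{F}_q$-subspace $V_0\subset V$ spanned over $\mathbb{F}_q$ by an $\mathbb{F}_{q^2}$-basis of $V$ such that the Hermitian form takes values in $\mathbb{F}_q$ on $V_0$ (so it restricts to a non-degenerate symmetric form on $V_0$, of either type), and extend the isometries of $V_0$ to $V$ by $\mathbb{F}_{q^2}$-linearity.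 The embedded $SO_n^\pm(q)$ is the determinant $1$ subgroup, contained in $SU_n(q)$. *)

theory Defs
  imports
    "HOL-Analysis.Analysis"
    "HOL-Algebra.Coset"
    "HOL-Number_Theory.Prime_Powers"
    "HOL-Number_Theory.Residues"
begin

definition strongly_real :: "('g, 'm) monoid_scheme \<Rightarrow> 'g \<Rightarrow> bool" where
  "strongly_real G g \<longleftrightarrow> g \<in> carrier G \<and>
     (\<exists>h\<in>carrier G. h \<otimes>\<^bsub>G\<^esub> g \<otimes>\<^bsub>G\<^esub> inv\<^bsub>G\<^esub> h = inv\<^bsub>G\<^esub> g \<and> h \<otimes>\<^bsub>G\<^esub> h = \<one>\<^bsub>G\<^esub>)"

definition matrix_monoid :: "('a::semiring_1^'n^'n) set \<Rightarrow> ('a^'n^'n) monoid" where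
  "matrix_monoid S = \<lparr>carrier = S, mult = (**), one = mat 1\<rparr>"

text \<open>
  Throughout, the field with \<open>q\<^sup>2\<close> elements is a type \<open>'a\<close> with \<open>CARD('a) = q\<^sup>2\<close>, and its
  subfield with \<open>q\<close> elements is the fixed field of \<open>x \<mapsto> x ^ q\<close>.
\<close>

definition subfield_Fq :: "nat \<Rightarrow> 'a::field set" where
  "subfield_Fq q = {x. x ^ q = x}"

definition frob :: "nat \<Rightarrow> 'a::field^'n^'m \<Rightarrow> 'a^'n^'m" where
  "frob q A = (\<chi> i j. (A $ i $ j) ^ q)"

definition hermitian_matrix :: "nat \<Rightarrow> 'a::field^'n^'n \<Rightarrow> bool" where
  "hermitian_matrix q \<eta> \<longleftrightarrow> transpose (frob q \<eta>) = \<eta>"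

definition herm_form :: "nat \<Rightarrow> 'a::field^'n^'n \<Rightarrow> 'a^'n \<Rightarrow> 'a^'n \<Rightarrow> 'a" where
  "herm_form q \<eta> x y = (\<Sum>i\<in>UNIV. \<Sum>j\<in>UNIV. (x $ i) ^ q * \<eta> $ i $ j * y $ j)"

definition GU :: "nat \<Rightarrow> 'a::field^'n^'n \<Rightarrow> ('a^'n^'n) set" where
  "GU q \<eta> = {g. invertible g \<and> (\<forall>x y. herm_form q \<eta> (g *v x) (g *v y) = herm_form q \<eta> x y)}"

definition SU :: "nat \<Rightarrow> 'a::field^'n^'n \<Rightarrow> ('a^'n^'n) set" where
  "SU q \<eta> = {g \<in> GU q \<eta>. det g = 1}"

definition span_Fq :: "nat \<Rightarrow> ('a::field^'n) set \<Rightarrow> ('a^'n) set" where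
  "span_Fq q B = {\<Sum>b\<in>B. c b *s b | c. \<forall>b\<in>B. c b \<in> subfield_Fq q}"

text \<open>The subspaces \<open>V\<^sub>0\<close> on which the Hermitian form restricts to a symmetric form over the
  field with \<open>q\<close> elements; the restriction may be of either type.\<close>

definition orthogonal_Fq_form :: "nat \<Rightarrow> 'a::field^'n^'n \<Rightarrow> ('a^'n) set \<Rightarrow> bool" where
  "orthogonal_Fq_form q \<eta> V\<^sub>0 \<longleftrightarrow>
     (\<exists>B. vec.independent B \<and> vec.span B = UNIV \<and> V\<^sub>0 = span_Fq q B) \<and>
     (\<forall>x\<in>V\<^sub>0. \<forall>y\<in>V\<^sub>0. herm_form q \<eta> x y \<in> subfield_Fq q)"

text \<open>Since \<open>V\<^sub>0\<close> contains a basis of the whole space, an isometry of \<open>V\<^sub>0\<close> has exactly one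
  linear extension; the following set consists of these extensions.\<close>

definition embedded_O :: "nat \<Rightarrow> 'a::field^'n^'n \<Rightarrow> ('a^'n) set \<Rightarrow> ('a^'n^'n) set" where
  "embedded_O q \<eta> V\<^sub>0 =
     {g. (*v) g ` V\<^sub>0 = V\<^sub>0 \<and>
         (\<forall>x\<in>V\<^sub>0. \<forall>y\<in>V\<^sub>0. herm_form q \<eta> (g *v x) (g *v y) = herm_form q \<eta> x y)}"

definition embedded_SO :: "nat \<Rightarrow> 'a::field^'n^'n \<Rightarrow> ('a^'n) set \<Rightarrow> ('a^'n^'n) set" where
  "embedded_SO q \<eta> V\<^sub>0 = {g \<in> embedded_O q \<eta> V\<^sub>0. det g = 1}"


lemma power_q_add:
  fixes x y :: "'a::{field,finite}"
  assumes "primepow q" "CARD('a) = q\<^sup>2"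
  shows "(x + y) ^ q = x ^ q + y ^ q"
proof -
  obtain p k where pk: "prime p" "k > 0" "q = p ^ k"
    using assms(1) unfolding primepow_def by blast
  have pr: "prime CHAR('a)"
    by (rule prime_CHAR_semidom) (use finite_imp_CHAR_pos[where ?'a='a] in simp)
  have "CHAR('a) dvd p ^ (k * 2)"
    using CHAR_dvd_CARD[where ?'a='a] assms(2) pk(3) by (simp add: power_mult)
  then have "CHAR('a) = p"
    using pr pk(1) by (meson prime_dvd_power_nat primes_dvd_imp_eq)
  then show ?thesis
    using freshmans_dream'[where ?'a='a, OF pr, of q k x y] pk(3) by simp
qed

lemma power_q_sum:
  fixes f :: "'i \<Rightarrow> 'a::{field,finite}"
  assumes "primepow q" "CARD('a) = q\<^sup>2"
  shows "(\<Sum>i\<in>I. f i) ^ q = (\<Sum>i\<in>I. f i ^ q)"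
proof -
  have "q > 0" using primepow_gt_Suc_0[OF assms(1)] by simp
  then show ?thesis
    by (induction I rule: infinite_finite_induct) (auto simp: power_q_add[OF assms])
qed

lemma herm_form_lin_right:
  "herm_form q \<eta> x (\<Sum>b\<in>B. c b *s f b) = (\<Sum>b\<in>B. c b * herm_form q \<eta> x (f b))"
proof -
  have "herm_form q \<eta> x (\<Sum>b\<in>B. c b *s f b)
      = (\<Sum>i\<in>UNIV. \<Sum>j\<in>UNIV. \<Sum>b\<in>B. (x $ i) ^ q * \<eta> $ i $ j * (c b * f b $ j))"
    by (simp add: herm_form_def sum_distrib_left)
  also have "\<dots> = (\<Sum>b\<in>B. \<Sum>i\<in>UNIV. \<Sum>j\<in>UNIV. (x $ i) ^ q * \<eta> $ i $ j * (c b * f b $ j))"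
    by (subst (2) sum.swap, subst sum.swap) simp
  also have "\<dots> = (\<Sum>b\<in>B. c b * herm_form q \<eta> x (f b))"
    by (simp add: herm_form_def sum_distrib_left mult_ac)
  finally show ?thesis .
qed

lemma herm_form_semilin_left:
  fixes \<eta> :: "'a::{field,finite}^'n^'n"
  assumes "primepow q" "CARD('a) = q\<^sup>2"
  shows "herm_form q \<eta> (\<Sum>b\<in>B. c b *s f b) y = (\<Sum>b\<in>B. c b ^ q * herm_form q \<eta> (f b) y)"
proof -
  have "herm_form q \<eta> (\<Sum>b\<in>B. c b *s f b) y
      = (\<Sum>i\<in>UNIV. \<Sum>j\<in>UNIV. \<Sum>b\<in>B. (c b * f b $ i) ^ q * \<eta> $ i $ j * y $ j)"
    by (simp add: herm_form_def sum_distrib_right power_q_sum[OF assms])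
  also have "\<dots> = (\<Sum>b\<in>B. \<Sum>i\<in>UNIV. \<Sum>j\<in>UNIV. (c b * f b $ i) ^ q * \<eta> $ i $ j * y $ j)"
    by (subst (2) sum.swap, subst sum.swap) simp
  also have "\<dots> = (\<Sum>b\<in>B. c b ^ q * herm_form q \<eta> (f b) y)"
    by (simp add: herm_form_def sum_distrib_left mult_ac power_mult_distrib)
  finally show ?thesis .
qed

lemma herm_form_eq_on_basis:
  fixes \<eta> :: "'a::{field,finite}^'n^'n"
    and B :: "('a^'n) set"
  assumes q: "primepow q" "CARD('a) = q\<^sup>2" and B: "vec.span B = UNIV"
    and eq: "\<And>x y. x \<in> B \<Longrightarrow> y \<in> B \<Longrightarrow>
               herm_form q \<eta> (g *v x) (g *v y) = herm_form q \<zeta> x y"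
  shows "herm_form q \<eta> (g *v x) (g *v y) = herm_form q \<zeta> x y"
proof -
  have B': "\<exists>c. z = (\<Sum>b\<in>B. c b *s b)" for z :: "'a^'n"
    using B vec.span_finite[of B] by auto
  obtain c where c: "x = (\<Sum>b\<in>B. c b *s b)" using B' by blast
  obtain d where d: "y = (\<Sum>b\<in>B. d b *s b)" using B' by blast
  have g: "g *v (\<Sum>b\<in>B. c b *s b) = (\<Sum>b\<in>B. c b *s (g *v b))" for c
    by (simp add: vec.sum vec.scale)
  have "herm_form q \<eta> (g *v x) (g *v y)
      = (\<Sum>b\<in>B. c b ^ q * (\<Sum>b'\<in>B. d b' * herm_form q \<eta> (g *v b) (g *v b')))"
    unfolding c d g herm_form_semilin_left[OF q] by (simp only: herm_form_lin_right)
  also have "\<dots> = (\<Sum>b\<in>B. c b ^ q * (\<Sum>b'\<in>B. d b' * herm_form q \<zeta> b b'))"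
    by (simp add: eq cong: sum.cong)
  also have "\<dots> = herm_form q \<zeta> x y"
    unfolding c d herm_form_semilin_left[OF q, where f = "\<lambda>b. b"]
    by (simp only: herm_form_lin_right[where f = "\<lambda>b. b"])
  finally show ?thesis .
qed

lemma invertible_inverseE:
  fixes g :: "'a::field^'n^'n"
  assumes "invertible g"
  obtains h where "g ** h = mat 1" "h ** g = mat 1" "invertible h"
  using assms unfolding invertible_def by blast

lemma matrix_inv_inverse:
  fixes A :: "'a::field^'n^'n"
  assumes "invertible A"
  shows "A ** matrix_inv A = mat 1" "matrix_inv A ** A = mat 1"
  using assms someI_ex[of "\<lambda>A'. A ** A' = mat 1 \<and> A' ** A = mat 1"]
  unfolding invertible_def matrix_inv_def by blast+

lemma mat_1_in_GU: "mat 1 \<in> GU q \<eta>"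
  by (auto simp: GU_def invertible_def intro: exI[of _ "mat 1"])

lemma mult_in_GU: "g \<in> GU q \<eta> \<Longrightarrow> h \<in> GU q \<eta> \<Longrightarrow> g ** h \<in> GU q \<eta>"
  by (auto simp: GU_def invertible_mult simp flip: matrix_vector_mul_assoc)

lemma inverse_in_GU:
  assumes "g \<in> GU q \<eta>" "g ** h = mat 1" "h ** g = mat 1"
  shows "h \<in> GU q \<eta>"
proof -
  have gh: "g *v (h *v x) = x" for x
    using assms(2) by (simp add: matrix_vector_mul_assoc)
  show ?thesis
    using assms gh unfolding GU_def invertible_def by (auto, metis)
qed

lemma group_SU: "group (matrix_monoid (SU q \<eta>))"
proof (rule groupI)
  fix g assume "g \<in> carrier (matrix_monoid (SU q \<eta>))"
  then have g: "g \<in> GU q \<eta>" "det g = 1" by (auto simp: matrix_monoid_def SU_def)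
  then obtain h where h: "g ** h = mat 1" "h ** g = mat 1"
    by (auto simp: GU_def elim: invertible_inverseE)
  have "det g * det h = 1" using h by (simp flip: det_mul)
  with g(2) have "h \<in> SU q \<eta>"
    using inverse_in_GU[OF g(1) h] by (simp add: SU_def)
  with h show "\<exists>h\<in>carrier (matrix_monoid (SU q \<eta>)).
      h \<otimes>\<^bsub>matrix_monoid (SU q \<eta>)\<^esub> g = \<one>\<^bsub>matrix_monoid (SU q \<eta>)\<^esub>"
    by (auto simp: matrix_monoid_def)
qed (auto simp: matrix_monoid_def SU_def mat_1_in_GU mult_in_GU det_mul matrix_mul_assoc)

lemma embedded_SO_subset_SU:
  fixes \<eta> :: "'a::{field,finite}^'n^'n"
  assumes q: "primepow q" "CARD('a) = q\<^sup>2" and V\<^sub>0: "orthogonal_Fq_form q \<eta> V\<^sub>0"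
  shows "embedded_SO q \<eta> V\<^sub>0 \<subseteq> SU q \<eta>"
proof
  fix g assume "g \<in> embedded_SO q \<eta> V\<^sub>0"
  then have g: "herm_form q \<eta> (g *v x) (g *v y) = herm_form q \<eta> x y"
      if "x \<in> V\<^sub>0" "y \<in> V\<^sub>0" for x y
    using that by (auto simp: embedded_SO_def embedded_O_def)
  have det: "det g = 1"
    using \<open>g \<in> embedded_SO q \<eta> V\<^sub>0\<close> by (simp add: embedded_SO_def)
  obtain B where B: "vec.span B = UNIV" "V\<^sub>0 = span_Fq q B"
    using V\<^sub>0 unfolding orthogonal_Fq_form_def by blast
  have "q > 0" using primepow_gt_Suc_0[OF q(1)] by simp
  have "B \<subseteq> V\<^sub>0"
  proof
    fix b assume b: "b \<in> B"
    let ?c = "\<lambda>b'. if b' = b then 1 else 0 :: 'a"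
    have "(\<Sum>b'\<in>B. ?c b' *s b') = (\<Sum>b'\<in>B. if b' = b then b' else 0)"
      by (rule sum.cong) auto
    also have "\<dots> = b" using b by simp
    finally have "b = (\<Sum>b'\<in>B. ?c b' *s b')" ..
    moreover have "\<forall>b'\<in>B. ?c b' \<in> subfield_Fq q"
      using \<open>q > 0\<close> by (simp add: subfield_Fq_def)
    ultimately show "b \<in> V\<^sub>0" 
      unfolding B(2) span_Fq_def by (intro CollectI exI[of _ ?c] conjI)
  qed
  then have "herm_form q \<eta> (g *v x) (g *v y) = herm_form q \<eta> x y" for x y
    using herm_form_eq_on_basis[OF q B(1), of \<eta> g \<eta>] g by blast
  with det show "g \<in> SU q \<eta>" by (simp add: SU_def GU_def invertible_det_nz)
qed

lemma subgroup_embedded_SO: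
  fixes \<eta> :: "'a::{field,finite}^'n^'n"
  assumes "primepow q" "CARD('a) = q\<^sup>2" and "orthogonal_Fq_form q \<eta> V\<^sub>0"
  shows "subgroup (embedded_SO q \<eta> V\<^sub>0) (matrix_monoid (SU q \<eta>))"
proof -
  interpret G: group "matrix_monoid (SU q \<eta>)" by (rule group_SU)
  show ?thesis
  proof (rule G.subgroupI)
    show "embedded_SO q \<eta> V\<^sub>0 \<subseteq> carrier (matrix_monoid (SU q \<eta>))"
      using embedded_SO_subset_SU[OF assms] by (simp add: matrix_monoid_def)
    have "mat 1 \<in> embedded_SO q \<eta> V\<^sub>0"
      by (auto simp: embedded_SO_def embedded_O_def)
    then show "embedded_SO q \<eta> V\<^sub>0 \<noteq> {}" by blast
  next
    fix g assume g: "g \<in> embedded_SO q \<eta> V\<^sub>0"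
    let ?h = "inv\<^bsub>matrix_monoid (SU q \<eta>)\<^esub> g"
    have gc: "g \<in> carrier (matrix_monoid (SU q \<eta>))"
      using g embedded_SO_subset_SU[OF assms] by (auto simp: matrix_monoid_def)
    have hc: "?h \<in> SU q \<eta>" using G.inv_closed[OF gc] by (simp add: matrix_monoid_def)
    have hg: "?h ** g = mat 1" using G.l_inv[OF gc] by (simp add: matrix_monoid_def)
    have h: "?h *v (g *v x) = x" for x using hg by (simp add: matrix_vector_mul_assoc)
    have gV: "(*v) g ` V\<^sub>0 = V\<^sub>0" using g by (simp add: embedded_SO_def embedded_O_def)
    have "(*v) ?h ` ((*v) g ` V\<^sub>0) = V\<^sub>0" by (simp add: image_image h)
    then have "(*v) ?h ` V\<^sub>0 = V\<^sub>0" by (simp add: gV)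
    with hc show "?h \<in> embedded_SO q \<eta> V\<^sub>0"
      by (simp add: embedded_SO_def embedded_O_def SU_def GU_def)
  next
    fix g h assume gh: "g \<in> embedded_SO q \<eta> V\<^sub>0" "h \<in> embedded_SO q \<eta> V\<^sub>0"
    then have im: "(*v) g ` V\<^sub>0 = V\<^sub>0" "(*v) h ` V\<^sub>0 = V\<^sub>0"
      by (auto simp: embedded_SO_def embedded_O_def)
    have "(*v) (g ** h) ` V\<^sub>0 = (*v) g ` ((*v) h ` V\<^sub>0)"
      by (simp add: image_image matrix_vector_mul_assoc)
    then have "(*v) (g ** h) ` V\<^sub>0 = V\<^sub>0" by (simp add: im)
    moreover have "g ** h \<in> SU q \<eta>"
      using subsetD[OF embedded_SO_subset_SU[OF assms] gh(1)]
        subsetD[OF embedded_SO_subset_SU[OF assms] gh(2)]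
      by (simp add: SU_def mult_in_GU det_mul)
    ultimately show "g \<otimes>\<^bsub>matrix_monoid (SU q \<eta>)\<^esub> h \<in> embedded_SO q \<eta> V\<^sub>0"
      by (simp add: matrix_monoid_def embedded_SO_def embedded_O_def SU_def GU_def)
  qed
qed

lemma herm_form_axis:
  assumes "q > 0"
  shows "herm_form q \<eta> (axis i 1) (axis j 1) = \<eta> $ i $ j"
proof -
  have "herm_form q \<eta> (axis i 1) (axis j 1)
      = (\<Sum>k\<in>UNIV. \<Sum>l\<in>UNIV. if k = i then if l = j then \<eta> $ k $ l else 0 else 0)"
    unfolding herm_form_def using assms by (intro sum.cong) (auto simp: axis_def)
  also have "\<dots> = (\<Sum>k\<in>UNIV. if k = i then \<eta> $ k $ j else 0)"
    by (intro sum.cong) auto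
  finally show ?thesis by simp
qed

lemma herm_form_mult:
  fixes \<eta> :: "'a::{field,finite}^'n^'n"
  assumes "primepow q" "CARD('a) = q\<^sup>2"
  shows "herm_form q \<eta> (g *v axis i 1) (g *v axis j 1) = (transpose (frob q g) ** \<eta> ** g) $ i $ j"
proof -
  have "(transpose (frob q g) ** \<eta> ** g) $ i $ j
      = (\<Sum>l\<in>UNIV. \<Sum>k\<in>UNIV. (g $ k $ i) ^ q * \<eta> $ k $ l * g $ l $ j)"
    by (simp add: matrix_matrix_mult_def transpose_def frob_def sum_distrib_right)
  also have "\<dots> = (\<Sum>k\<in>UNIV. \<Sum>l\<in>UNIV. (g $ k $ i) ^ q * \<eta> $ k $ l * g $ l $ j)"
    by (rule sum.swap)
  also have "\<dots> = herm_form q \<eta> (g *v axis i 1) (g *v axis j 1)"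
    by (simp add: herm_form_def matrix_vector_mult_def axis_def if_distrib cong: if_cong)
  finally show ?thesis ..
qed

lemma frob_mult:
  fixes A B :: "'a::{field,finite}^'n^'n"
  assumes "primepow q" "CARD('a) = q\<^sup>2"
  shows "frob q (A ** B) = frob q A ** frob q B"
  by (simp add: frob_def matrix_matrix_mult_def vec_eq_iff power_q_sum[OF assms] power_mult_distrib)

lemma frob_mat_1: "q > 0 \<Longrightarrow> frob q (mat 1) = mat 1"
  by (auto simp: frob_def mat_def vec_eq_iff)

lemma GU_iff_transpose_frob:
  fixes \<eta> :: "'a::{field,finite}^'n^'n"
  assumes q: "primepow q" "CARD('a) = q\<^sup>2"
  shows "g \<in> GU q \<eta> \<longleftrightarrow> invertible g \<and> transpose (frob q g) ** \<eta> ** g = \<eta>"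
proof -
  have "q > 0" using primepow_gt_Suc_0[OF q(1)] by simp
  let ?B = "range (\<lambda>i. axis i 1) :: ('a^'n) set"
  have B: "vec.span ?B = UNIV"
    using span_cart_basis by (simp add: cart_basis_def full_SetCompr_eq)
  have "(\<forall>x y. herm_form q \<eta> (g *v x) (g *v y) = herm_form q \<eta> x y) \<longleftrightarrow>
      (\<forall>x\<in>?B. \<forall>y\<in>?B. herm_form q \<eta> (g *v x) (g *v y) = herm_form q \<eta> x y)"
    using herm_form_eq_on_basis[OF q B, of \<eta> g \<eta>] by blast
  also have "\<dots> \<longleftrightarrow> transpose (frob q g) ** \<eta> ** g = \<eta>"
    by (simp add: herm_form_mult[OF q] herm_form_axis[OF \<open>q > 0\<close>] vec_eq_iff)
  finally show ?thesis by (simp add: GU_def)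
qed

text \<open>The isometry group consists of the fixed points of
  \<open>g \<mapsto> \<eta>\<^sup>-\<^sup>1 (\<^sup>TF(g)\<^sup>-\<^sup>1) \<eta>\<close>.\<close>

lemma GU_iff_fixed_point:
  fixes \<eta> :: "'a::{field,finite}^'n^'n"
  assumes q: "primepow q" "CARD('a) = q\<^sup>2" and \<eta>: "invertible \<eta>"
  shows "g \<in> GU q \<eta> \<longleftrightarrow>
    invertible g \<and> matrix_inv \<eta> ** transpose (matrix_inv (frob q g)) ** \<eta> = g"
proof (cases "invertible g")
  case True
  have "q > 0" using primepow_gt_Suc_0[OF q(1)] by simp
  obtain h where h: "g ** h = mat 1" "h ** g = mat 1"
    using True by (rule invertible_inverseE)
  let ?F = "frob q g" and ?e = "matrix_inv \<eta>" and ?T = "transpose (matrix_inv (frob q g))"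
  have "invertible ?F"
    unfolding invertible_def
    by (intro exI[of _ "frob q h"]) (simp add: h frob_mat_1[OF \<open>q > 0\<close>] flip: frob_mult[OF q])
  then have "?F ** matrix_inv ?F = mat 1" "matrix_inv ?F ** ?F = mat 1"
    by (simp_all add: matrix_inv_inverse)
  then have T: "?T ** transpose ?F = mat 1" "transpose ?F ** ?T = mat 1"
    by (simp_all flip: matrix_transpose_mul add: transpose_mat)
  have e: "?e ** \<eta> = mat 1" "\<eta> ** ?e = mat 1"
    using \<eta> by (simp_all add: matrix_inv_inverse)
  have "transpose ?F ** \<eta> ** g = \<eta> \<longleftrightarrow> ?e ** ?T ** \<eta> = g"
  proof
    assume "transpose ?F ** \<eta> ** g = \<eta>"
    then have "?e ** ?T ** \<eta> = ?e ** ((?T ** transpose ?F) ** (\<eta> ** g))"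
      by (metis matrix_mul_assoc)
    also have "\<dots> = (?e ** \<eta>) ** g" by (simp only: T matrix_mul_lid matrix_mul_assoc)
    finally show "?e ** ?T ** \<eta> = g" by (simp add: e)
  next
    assume "?e ** ?T ** \<eta> = g"
    then have "transpose ?F ** \<eta> ** g = transpose ?F ** ((\<eta> ** ?e) ** (?T ** \<eta>))"
      by (metis matrix_mul_assoc)
    also have "\<dots> = (transpose ?F ** ?T) ** \<eta>"
      by (simp only: e matrix_mul_lid matrix_mul_assoc)
    finally show "transpose ?F ** \<eta> ** g = \<eta>" by (simp add: T)
  qed
  with True show ?thesis by (simp add: GU_iff_transpose_frob[OF q])
qed (simp add: GU_def)

end

theory Submission
  imports Defs
begin

text \<open>
  Let \<open>s\<close> be an involution inverting \<open>g\<close>. Both already lie in one embedded special orthogonal group,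
  so \<open>s\<close> itself witnesses strong reality there: the point is to find an \<open>\<langle>s, g\<rangle>\<close>-stable
  subspace over the field with \<open>q\<close> elements that spans \<open>V\<close> and on which the form is \<open>F\<^sub>q\<close>-valued.
  A maximal stable, non-degenerate, \<open>F\<^sub>q\<close>-valued subspace spans a non-degenerate subspace, so by
  passing to the orthogonal complement it suffices to find a nonzero one inside a minimal
  non-degenerate stable subspace \<open>U\<close>. There every self-adjoint operator commuting with \<open>s\<close> and \<open>g\<close>
  is nilpotent or bijective (Fitting). In particular \<open>g + 1\<close> or \<open>g - 1\<close> is bijective on \<open>U\<close>, and up to
  replacing \<open>g\<close> by \<open>- g\<close> the Cayley transform \<open>y = (g - 1) / (g + 1)\<close> is a skew-adjoint operator
  anticommuting with \<open>s\<close> that determines \<open>g\<close>. Now \<open>y\<^sup>2\<close> is self-adjoint. If it is nilpotent, the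
  \<open>F\<^sub>q[y]\<close>-span of one or two suitably normalised eigenvectors of \<open>s\<close> works. If it is bijective,
  \<open>F\<^sub>q[y\<^sup>2]\<close> acts on \<open>U\<close> through a local ring with simple socle, and any eigenvector \<open>v\<close> of \<open>s\<close> with
  \<open>\<langle>v, n v\<rangle> \<noteq> 0\<close>, for \<open>n\<close> generating the socle, yields the subspace \<open>F\<^sub>q[y] v\<close>.
\<close>

hide_const (open) up_ring.coeff up_ring.monom Module.smult

section \<open>Powers of a self-map of a finite type\<close>

text \<open>By pigeonhole the powers of \<open>f\<close> are periodic with some period
  \<open>d\<close> from some index \<open>i\<close> on. The exponent \<open>d * (i + 1)\<close> is a
  multiple of \<open>d\<close> and at least \<open>i\<close>, so doubling it changes nothing. This
  supplies both the Fitting projection and the idempotent Frobenius power used below.\<close>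

lemma funpow_idempotent_exists:
  fixes f :: "'b::finite \<Rightarrow> 'b"
  obtains N where "N \<ge> 1" "\<And>v. (f ^^ N) ((f ^^ N) v) = (f ^^ N) v"
proof -
  have "\<not> inj (\<lambda>i. f ^^ i)"
    using finite_imageD[of "\<lambda>i. f ^^ i" UNIV] infinite_UNIV_nat by (metis finite)
  then obtain i j where ij: "f ^^ i = f ^^ j" "i < j"
    unfolding inj_def by (metis linorder_neqE_nat)
  define d where "d = j - i"
  have d: "d > 0" "f ^^ (i + d) = f ^^ i" using ij by (auto simp: d_def)
  have step: "f ^^ (n + d) = f ^^ n" if "n \<ge> i" for n
  proof -
    have "f ^^ (n + d) = f ^^ (n - i) \<circ> f ^^ (i + d)" using that by (simp flip: funpow_add)
    also have "\<dots> = f ^^ n" unfolding d(2) using that by (simp flip: funpow_add)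
    finally show ?thesis .
  qed
  have mult: "f ^^ (n + d * k) = f ^^ n" if "n \<ge> i" for n k
  proof (induction k)
    case (Suc k)
    have "f ^^ (n + d * Suc k) = f ^^ ((n + d * k) + d)" by (simp add: algebra_simps)
    also have "\<dots> = f ^^ n" using step[of "n + d * k"] that Suc by simp
    finally show ?case .
  qed simp
  have "d * (i + 1) \<ge> 1 * (i + 1)" using d by (intro mult_right_mono) auto
  then have "d * (i + 1) \<ge> i" by (metis add_leD1 mult_1)
  moreover have "d * (i + 1) \<ge> 1" using d by simp
  ultimately have "f ^^ (d * (i + 1) + d * (i + 1)) = f ^^ (d * (i + 1))" "d * (i + 1) \<ge> 1"
    using mult[of "d * (i + 1)" "i + 1"] by auto
  then show thesis by (intro that[of "d * (i + 1)"]) (auto simp: funpow_add o_def fun_eq_iff)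
qed

section \<open>Polynomials in an operator\<close>

abbreviation lin :: "('a::field^'n \<Rightarrow> 'a^'n) \<Rightarrow> bool" where
  "lin \<equiv> Vector_Spaces.linear (*s) (*s)"

lemma lin_funpow: "lin f \<Longrightarrow> lin (f ^^ n)"
  by (induction n) (auto intro: Vector_Spaces.linear_compose vec.linear_id)

lemma funpow_commute_op:
  assumes "\<And>v. f (k v) = k (f v)"
  shows "(f ^^ n) (k v) = k ((f ^^ n) v)"
  by (induction n) (auto simp: assms)

lemma funpow_mem:
  assumes "\<And>u. u \<in> U \<Longrightarrow> f u \<in> U" "u \<in> U"
  shows "(f ^^ n) u \<in> U"
  by (induction n) (auto simp: assms)

text \<open>Horner's scheme for the action of \<open>p(f)\<close> on \<open>v\<close>; for linear
  \<open>f\<close> it makes the vectors a module over the polynomial ring.\<close>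

definition poly_app :: "('a::field^'n \<Rightarrow> 'a^'n) \<Rightarrow> 'a poly \<Rightarrow> 'a^'n \<Rightarrow> 'a^'n" where
  "poly_app f p v = fold_coeffs (\<lambda>c w. c *s v + f w) p 0"

lemma poly_app_0 [simp]: "poly_app f 0 v = 0"
  by (simp add: poly_app_def)

lemma poly_app_pCons [simp]:
  assumes "lin f"
  shows "poly_app f (pCons c p) v = c *s v + f (poly_app f p v)"
proof (cases "c = 0 \<and> p = 0")
  case True
  then show ?thesis using vec.linear_0[OF assms] by simp
next
  case False
  then show ?thesis by (auto simp: poly_app_def)
qed

lemma poly_app_1 [simp]: "lin f \<Longrightarrow> poly_app f 1 v = v"
  by (simp add: one_pCons vec.linear_0)

lemma poly_app_add:
  assumes f: "lin f"
  shows "poly_app f (p + r) v = poly_app f p v + poly_app f r v"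
proof (induction p arbitrary: r)
  case (pCons a p)
  show ?case
  proof (cases r)
    case (pCons b r')
    then show ?thesis
      using f pCons.IH[of r']
      by (simp add: vec.linear_add[OF f] vec.scale_left_distrib algebra_simps)
  qed
qed simp

lemma poly_app_smult:
  assumes f: "lin f"
  shows "poly_app f (smult c p) v = c *s poly_app f p v"
  by (induction p) (use f in \<open>auto simp: vec.linear_scale[OF f] vec.scale_right_distrib\<close>)

lemma poly_app_minus:
  assumes f: "lin f"
  shows "poly_app f (- p) v = - poly_app f p v"
  using poly_app_smult[OF f, of "-1" p v] by simp

lemma poly_app_diff:
  assumes f: "lin f"
  shows "poly_app f (p - r) v = poly_app f p v - poly_app f r v"
  using poly_app_add[OF f, of p "- r" v] poly_app_minus[OF f, of r v] by simp

lemma poly_app_mult: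
  assumes f: "lin f"
  shows "poly_app f (p * r) v = poly_app f p (poly_app f r v)"
  by (induction p) (use f in \<open>auto simp: poly_app_add[OF f] poly_app_smult[OF f]\<close>)

lemma poly_app_power:
  assumes f: "lin f"
  shows "poly_app f (p ^ n) v = (poly_app f p ^^ n) v"
  by (induction n) (use f in \<open>auto simp: poly_app_mult[OF f]\<close>)

lemma lin_poly_app:
  assumes f: "lin f"
  shows "lin (poly_app f p)"
proof (induction p)
  case 0
  then show ?case by (simp add: poly_app_def[abs_def] vec.linear_zero)
next
  case (pCons c p)
  have "poly_app f (pCons c p) = (\<lambda>v. c *s v + f (poly_app f p v))"
    using f by (simp add: fun_eq_iff)
  moreover have "lin (\<lambda>v. c *s v + f (poly_app f p v))"
    using Vector_Spaces.linear_compose[OF pCons.IH f] 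
    by (intro vec.linear_compose_add vec.linear_scale_self) (simp add: o_def)
  ultimately show ?case by simp
qed

lemma poly_app_commute:
  assumes f: "lin f" and k: "lin k" "\<And>v. f (k v) = k (f v)"
  shows "poly_app f p (k v) = k (poly_app f p v)"
  by (induction p)
    (use f in \<open>auto simp: vec.linear_0[OF k(1)] vec.linear_add[OF k(1)] vec.linear_scale[OF k(1)] k(2)\<close>)

lemma poly_app_mem_subspace:
  assumes f: "lin f" and U: "vec.subspace U" "\<And>u. u \<in> U \<Longrightarrow> f u \<in> U" and "u \<in> U"
  shows "poly_app f p u \<in> U"
  by (induction p) (use assms in \<open>auto intro: vec.subspace_0 vec.subspace_add vec.subspace_scale\<close>)

lemma poly_app_X_power:
  assumes f: "lin f"
  shows "poly_app f (monom 1 n) v = (f ^^ n) v"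
  by (induction n) (use f in \<open>auto simp: monom_0 monom_Suc vec.linear_0[OF f]\<close>)

lemma poly_app_pcompose:
  assumes f: "lin f"
  shows "poly_app f (pcompose p r) v = poly_app (poly_app f r) p v"
  by (induction p)
    (use f lin_poly_app[OF f, of r] in
      \<open>auto simp: pcompose_pCons poly_app_add[OF f] poly_app_mult[OF f] vec.linear_0[OF f]\<close>)

section \<open>The field with \<open>q\<^sup>2\<close> elements\<close>

text \<open>The field with \<open>q\<close> elements is only a subset of the type \<open>'a\<close>,
  so its polynomial ring is cut out of \<open>'a poly\<close> by a predicate.\<close>

definition qpoly :: "nat \<Rightarrow> 'a::field poly \<Rightarrow> bool" where
  "qpoly q p \<longleftrightarrow> (\<forall>i. coeff p i \<in> subfield_Fq q)"

text \<open>Multiplication by a nonzero \<open>x\<close> permutes the nonzero elements, so the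
  factor \<open>x ^ (CARD('a) - 1)\<close> leaves their nonzero product unchanged.\<close>

lemma power_card_eq_same: "(x :: 'a::{field,finite}) ^ CARD('a) = x"
proof (cases "x = 0")
  case False
  have "(\<Prod>y\<in>UNIV-{0}. x * y) = (\<Prod>y\<in>UNIV-{0}. y)"
    by (rule prod.reindex_bij_witness[of _ "\<lambda>y. y / x" "\<lambda>y. x * y"]) (use False in auto)
  then have "x ^ (CARD('a) - 1) = 1"
    by (simp add: prod.distrib card_Diff_singleton)
  then show ?thesis
    using power_minus_mult[of "CARD('a)" x] by simp
qed simp

locale quadratic_field =
  fixes q :: nat and T :: "'a::{field,finite} itself"
  assumes q_primepow: "primepow q" and q_odd: "odd q" and card: "CARD('a) = q\<^sup>2"
begin

abbreviation Fq :: "'a set" where "Fq \<equiv> subfield_Fq q"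

lemma q_gt_1: "q > 1"
  using primepow_gt_Suc_0[OF q_primepow] by simp

lemma q_pos [simp]: "q > 0" "q \<noteq> 0"
  using q_gt_1 by auto

lemma power_add_q: "(x + y :: 'a) ^ q = x ^ q + y ^ q"
  by (rule power_q_add[OF q_primepow card])

lemma char_power:
  obtains k where "prime CHAR('a)" "k > 0" "q = CHAR('a) ^ k"
proof -
  obtain p k where pk: "prime p" "k > 0" "q = p ^ k"
    using q_primepow unfolding primepow_def by blast
  have pr: "prime CHAR('a)"
    by (rule prime_CHAR_semidom) (use finite_imp_CHAR_pos[where ?'a='a] in simp)
  have "CHAR('a) dvd p ^ (k * 2)"
    using CHAR_dvd_CARD[where ?'a='a] card pk(3) by (simp add: power_mult)
  then have "CHAR('a) = p"
    using pr pk(1) by (meson prime_dvd_power_nat primes_dvd_imp_eq)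
  then show ?thesis using that pk pr by blast
qed

lemma two_neq_0 [simp]: "(2::'a) \<noteq> 0"
proof
  assume "(2::'a) = 0"
  then have "CHAR('a) dvd 2" 
    using of_nat_eq_0_iff_char_dvd[where ?'a='a, of 2] by simp
  moreover obtain k where "prime CHAR('a)" "k > 0" "q = CHAR('a) ^ k" by (rule char_power)
  ultimately show False using q_odd by (metis even_power primes_dvd_imp_eq two_is_prime_nat dvd_refl)
qed

lemma minus_power_q: "(- x :: 'a) ^ q = - (x ^ q)"
  using q_odd by simp

lemma power_diff_q: "(x - y :: 'a) ^ q = x ^ q - y ^ q"
  using power_add_q[of x "- y"] minus_power_q by simp

lemma power_q_q [simp]: "((x::'a) ^ q) ^ q = x"
  using power_card_eq_same[of x] card by (simp add: power2_eq_square power_mult)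

lemma Fq_0 [simp]: "0 \<in> Fq" and Fq_1 [simp]: "1 \<in> Fq"
  by (auto simp: subfield_Fq_def)

lemma Fq_add [intro]: "a \<in> Fq \<Longrightarrow> b \<in> Fq \<Longrightarrow> a + b \<in> Fq"
  and Fq_diff [intro]: "a \<in> Fq \<Longrightarrow> b \<in> Fq \<Longrightarrow> a - b \<in> Fq"
  and Fq_mult [intro]: "a \<in> Fq \<Longrightarrow> b \<in> Fq \<Longrightarrow> a * b \<in> Fq"
  and Fq_minus [intro]: "a \<in> Fq \<Longrightarrow> - a \<in> Fq"
  and Fq_divide [intro]: "a \<in> Fq \<Longrightarrow> b \<in> Fq \<Longrightarrow> a / b \<in> Fq"
  by (auto simp: subfield_Fq_def power_add_q power_diff_q power_mult_distrib minus_power_q power_divide)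

lemma Fq_sum: "(\<And>i. i \<in> I \<Longrightarrow> f i \<in> Fq) \<Longrightarrow> sum f I \<in> Fq"
  by (induction I rule: infinite_finite_induct) auto

text \<open>Otherwise \<open>X^q - X\<close> would have \<open>q^2\<close> roots, more than its
  degree allows.\<close>

lemma exists_not_Fq: "\<exists>\<omega>::'a. \<omega> \<notin> Fq"
proof (rule ccontr)
  assume "\<nexists>\<omega>::'a. \<omega> \<notin> Fq"
  then have all: "x ^ q = x" for x :: 'a by (auto simp: subfield_Fq_def)
  define p :: "'a poly" where "p = monom 1 q - monom 1 1"
  have cf: "coeff p q = 1" using q_gt_1 by (simp add: p_def)
  then have "p \<noteq> 0" by auto
  have "degree p \<le> q" unfolding p_def
    using q_gt_1 by (intro degree_diff_le order.trans[OF degree_monom_le]) auto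
  have "{x. poly p x = 0} = UNIV" using all by (auto simp: p_def poly_monom)
  then have "CARD('a) \<le> q" 
    using card_poly_roots_bound[OF \<open>p \<noteq> 0\<close>] \<open>degree p \<le> q\<close> by simp
  then show False using card q_gt_1 by (simp add: power2_eq_square)
qed

definition \<omega> :: 'a where "\<omega> = (SOME x. x \<notin> Fq)"

lemma omega: "\<omega> \<notin> Fq"
  unfolding \<omega>_def using exists_not_Fq by (rule someI_ex)

lemma Fq_decompose:
  obtains a b where "a \<in> Fq" "b \<in> Fq" "(c::'a) = a + \<omega> * b"
proof -
  \<comment> \<open>Subtracting from \<open>c = a + \<omega> * b\<close> its \<open>q\<close>-th
    power eliminates \<open>a\<close> and forces this value of \<open>b\<close>.\<close>
  define b where "b = (c - c ^ q) / (\<omega> - \<omega> ^ q)"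
  have w: "\<omega> - \<omega> ^ q \<noteq> 0" using omega by (auto simp: subfield_Fq_def)
  have "b ^ q = (c ^ q - c) / (\<omega> ^ q - \<omega>)"
    by (simp add: b_def power_divide power_diff_q)
  also have "\<dots> = b" unfolding b_def using w by (simp add: divide_simps) (simp add: algebra_simps)
  finally have b: "b ^ q = b" .
  have "b * (\<omega> - \<omega> ^ q) = c - c ^ q" using w by (simp add: b_def)
  then have "c ^ q - \<omega> ^ q * b = c - \<omega> * b" by (simp add: algebra_simps)
  then have "(c - \<omega> * b) ^ q = c - \<omega> * b" by (simp add: power_diff_q power_mult_distrib b)
  then show thesis using b by (intro that[of "c - \<omega> * b" b]) (auto simp: subfield_Fq_def)
qed

lemma Fq_omega_eq_0:
  assumes "a \<in> Fq" "b \<in> Fq" "a + \<omega> * b = 0"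
  shows "a = 0" "b = 0"
proof -
  show "b = 0"
  proof (rule ccontr)
    assume b: "b \<noteq> 0"
    have "\<omega> = (- a) / b" using assms(3) b by (simp add: field_simps add_eq_0_iff)
    also have "\<dots> \<in> Fq" using assms by auto
    finally show False using omega by simp
  qed
  then show "a = 0" using assms by simp
qed

abbreviation qp :: "'a poly \<Rightarrow> bool" where "qp \<equiv> qpoly q"

lemma qp_0 [simp]: "qp 0" by (simp add: qpoly_def)

lemma qp_pCons [simp]: "qp (pCons c p) \<longleftrightarrow> c \<in> Fq \<and> qp p"
  by (auto simp: qpoly_def coeff_pCons split: nat.split)

lemma qp_1 [simp]: "qp 1" by (simp add: one_pCons)

lemma qp_add [intro]: "qp p \<Longrightarrow> qp r \<Longrightarrow> qp (p + r)"
  and qp_diff [intro]: "qp p \<Longrightarrow> qp r \<Longrightarrow> qp (p - r)"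
  and qp_minus [intro]: "qp p \<Longrightarrow> qp (- p)"
  and qp_smult [intro]: "c \<in> Fq \<Longrightarrow> qp p \<Longrightarrow> qp (smult c p)"
  and qp_mult [intro]: "qp p \<Longrightarrow> qp r \<Longrightarrow> qp (p * r)"
  by (auto simp: qpoly_def coeff_mult intro!: Fq_sum Fq_add Fq_diff Fq_minus Fq_mult)

lemma qp_power [intro]: "qp p \<Longrightarrow> qp (p ^ n)"
  by (induction n) auto

lemma qp_monom [simp]: "qp (monom 1 n)"
  by (auto simp: qpoly_def)

lemma qp_induct [consumes 1, case_names 0 pCons]:
  assumes "qp p" "P 0" "\<And>c p. c \<in> Fq \<Longrightarrow> qp p \<Longrightarrow> P p \<Longrightarrow> P (pCons c p)"
  shows "P p"
  using assms(1) by (induction p) (use assms(2,3) in auto)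

lemma Fq_power: "c \<in> Fq \<Longrightarrow> c ^ (q ^ k) = c"
  by (induction k) (auto simp: power_mult subfield_Fq_def)

text \<open>Raising to the power \<open>q ^ k\<close> is additive and fixes the coefficients, so
  only the variable is affected. Combined with \<open>poly_app_pcompose\<close>, a power of a
  polynomial in an operator becomes the same polynomial in a power of that operator.\<close>

lemma qp_frobenius:
  assumes "qp p"
  shows "p ^ (q ^ k) = pcompose p (monom 1 (q ^ k))"
  using assms
proof (induction p rule: qp_induct)
  case 0
  then show ?case by (simp add: power_0_left)
next
  case (pCons c p)
  obtain m where m: "prime CHAR('a)" "q = CHAR('a) ^ m" by (rule char_power)
  have dream: "(x + y) ^ (q ^ k) = x ^ (q ^ k) + y ^ (q ^ k)" for x y :: "'a poly"
    by (rule freshmans_dream'[where n = "m * k"]) (use m in \<open>auto simp: power_mult\<close>)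
  have pc: "pCons c p = [:c:] + monom 1 1 * p"
    by (simp add: monom_Suc monom_0)
  have "pCons c p ^ (q ^ k) = [:c:] ^ (q ^ k) + monom 1 1 ^ (q ^ k) * p ^ (q ^ k)"
    unfolding pc dream by (simp add: power_mult_distrib)
  also have "[:c:] ^ (q ^ k) = [:c:]"
    using Fq_power[OF pCons(1)] by (simp add: poly_const_pow)
  finally show ?case
    using pCons by (simp add: pcompose_pCons monom_power)
qed

text \<open>By \<open>qp_frobenius\<close> the difference is \<open>p(X) - p(Y)\<close> with
  \<open>Y = X^(q^k)\<close>, and \<open>X - Y\<close> always divides it; the induction keeps track
  that the quotient has coefficients in \<open>Fq\<close>.\<close>

lemma qp_frobenius_diff:
  assumes "qp p"
  shows "\<exists>d. qp d \<and> p - p ^ (q ^ k) = (monom 1 1 - monom 1 (q ^ k)) * d"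
  unfolding qp_frobenius[OF assms] using assms
proof (induction p rule: qp_induct)
  case 0
  then show ?case by (intro exI[of _ 0]) auto
next
  case (pCons c p)
  define Y :: "'a poly" where "Y = monom 1 (q ^ k)"
  define X :: "'a poly" where "X = monom 1 1"
  obtain d where d: "qp d" "p - pcompose p Y = (X - Y) * d"
    using pCons.IH unfolding X_def Y_def by blast
  have pc: "pCons c p = [:c:] + X * p"
    by (simp add: X_def monom_Suc monom_0)
  have "pCons c p - pcompose (pCons c p) Y = X * p - Y * pcompose p Y"
    by (simp add: pcompose_pCons X_def monom_Suc monom_0)
  also have "\<dots> = (X - Y) * p + Y * (p - pcompose p Y)" by (simp add: algebra_simps)
  also have "\<dots> = (X - Y) * (p + Y * d)" unfolding d(2) by (simp only: algebra_simps)
  finally have "pCons c p - pcompose (pCons c p) Y = (X - Y) * (p + Y * d)" .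
  moreover have "qp (p + Y * d)" using d(1) pCons(2) unfolding Y_def by (intro qp_add qp_mult qp_monom)
  ultimately show ?case by (auto simp: X_def Y_def)
qed

end

section \<open>Hermitian spaces with a skew-adjoint operator\<close>

locale hermitian_space = quadratic_field q "TYPE('a)"
  for q :: nat and H :: "'a::{field,finite}^'n \<Rightarrow> 'a^'n \<Rightarrow> 'a" +
  assumes H_add: "H u (v + w) = H u v + H u w"
    and H_scale: "H u (c *s v) = c * H u v"
    and H_conj: "(H u v) ^ q = H v u"
    and H_nondegenerate: "(\<And>v. H u v = 0) \<Longrightarrow> u = 0"
begin

lemma H_add_left: "H (u + v) w = H u w + H v w"
  by (simp add: H_add power_add_q flip: H_conj[of w])

lemma H_scale_left: "H (c *s u) v = c ^ q * H u v"
  by (simp add: H_scale power_mult_distrib flip: H_conj[of v])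

lemma H_scale_left_Fq: "c \<in> Fq \<Longrightarrow> H (c *s u) v = c * H u v"
  by (simp add: H_scale_left subfield_Fq_def)

lemma H_0 [simp]: "H u 0 = 0" "H 0 u = 0"
  using H_scale[of u 0 0] H_scale_left[of 0 0 u] by (auto simp: power_0_left)

lemma H_minus: "H u (- v) = - H u v" "H (- u) v = - H u v"
  using H_scale[of u "-1" v] H_scale_left[of "-1" u v] by (simp_all add: minus_power_q)

lemma H_diff: "H u (v - w) = H u v - H u w" "H (u - v) w = H u w - H v w"
  using H_add[of u v "- w"] H_add_left[of u "- v" w] by (simp_all add: H_minus)

lemma H_eq_0_sym: "H u v = 0 \<longleftrightarrow> H v u = 0"
  using H_conj[of u v] H_conj[of v u] by (metis q_pos(2) power_0_left)

lemma H_in_Fq: "H u v = H v u \<Longrightarrow> H u v \<in> Fq"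
  using H_conj[of u v] by (simp add: subfield_Fq_def)

definition nondegenerate :: "('a^'n) set \<Rightarrow> bool" where
  "nondegenerate W \<longleftrightarrow> (\<forall>u\<in>W. (\<forall>v\<in>W. H v u = 0) \<longrightarrow> u = 0)"

definition Fq_subspace :: "('a^'n) set \<Rightarrow> bool" where
  "Fq_subspace W \<longleftrightarrow> 0 \<in> W \<and> (\<forall>u\<in>W. \<forall>v\<in>W. u + v \<in> W) \<and> (\<forall>c\<in>Fq. \<forall>u\<in>W. c *s u \<in> W)"

text \<open>With values in \<open>Fq\<close>, the identity \<open>H_conj\<close> says that
  \<open>H\<close> is symmetric on \<open>W\<close>. Spanning is not demanded, so that such sets can
  be enlarged by orthogonal sums.\<close>

definition quadratic_Fq_subspace :: "('a^'n) set \<Rightarrow> bool" where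
  "quadratic_Fq_subspace W \<longleftrightarrow>
     Fq_subspace W \<and> (\<forall>u\<in>W. \<forall>v\<in>W. H u v \<in> Fq) \<and> nondegenerate W"

lemma nondegenerateD: "nondegenerate W \<Longrightarrow> u \<in> W \<Longrightarrow> (\<And>v. v \<in> W \<Longrightarrow> H v u = 0) \<Longrightarrow> u = 0"
  by (auto simp: nondegenerate_def)

lemma funpow_adjoint:
  assumes "\<And>u v. H (f u) v = H u (f v)"
  shows "H ((f ^^ n) u) v = H u ((f ^^ n) v)"
  by (induction n arbitrary: v) (simp_all add: assms funpow_swap1[symmetric])

lemma funpow_skew_adjoint:
  assumes "\<And>u v. H (f u) v = - H u (f v)"
  shows "H ((f ^^ n) u) v = (- 1) ^ n * H u ((f ^^ n) v)"
  by (induction n arbitrary: v) (simp_all add: assms funpow_swap1[symmetric])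

lemma poly_app_adjoint:
  assumes f: "lin f" and adj: "\<And>u v. H (f u) v = H u (f v)" and p: "qp p"
  shows "H (poly_app f p u) v = H u (poly_app f p v)"
  using p
proof (induction p arbitrary: v rule: qp_induct)
  case (pCons c p)
  have "f (poly_app f p v) = poly_app f p (f v)"
    using poly_app_commute[OF f f] by simp
  then show ?case
    using pCons f by (simp add: H_add H_add_left H_scale H_scale_left_Fq adj)
qed simp

text \<open>Polarisation: if \<open>H v (f v)\<close> vanished on all of \<open>T\<close>, rescaling
  \<open>b\<close> to make both cross terms equal to 1 would give \<open>a + c *s b\<close> the
  value 2, which is nonzero in odd characteristic.\<close>

lemma exists_anisotropic:
  assumes T: "vec.subspace T" and f: "lin f" "\<And>u v. H (f u) v = H u (f v)"
    and ab: "a \<in> T" "b \<in> T" "H a (f b) \<noteq> 0"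
  shows "\<exists>v\<in>T. H v (f v) \<noteq> 0"
proof (rule ccontr)
  assume "\<not> ?thesis"
  then have iso: "H v (f v) = 0" if "v \<in> T" for v using that by blast
  define c where "c = 1 / H a (f b)"
  have cb: "c *s b \<in> T" "a + c *s b \<in> T" using T ab by (auto intro: vec.subspace_add vec.subspace_scale)
  have one: "H a (f (c *s b)) = 1"
    using ab(3) by (simp add: vec.linear_scale[OF f(1)] H_scale c_def)
  have "H (c *s b) (f a) = H a (f (c *s b)) ^ q"
    by (simp add: H_conj f(2))
  then have "H (c *s b) (f a) = 1" using one by simp
  then have "H (a + c *s b) (f (a + c *s b)) = 2"
    using iso[OF ab(1)] iso[OF cb(1)] one
    by (simp add: vec.linear_add[OF f(1)] H_add H_add_left)
  then show False using iso[OF cb(2)] two_neq_0 by metis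
qed

end

section \<open>Stable subspaces for a skew-adjoint operator anticommuting with an involution\<close>

text \<open>This is the situation reached by the Cayley transform. The last assumption is what
  minimality of \<open>U\<close> yields through \<open>fitting\<close>.\<close>

locale skew_pair = hermitian_space q H
  for q :: nat and H :: "'a::{field,finite}^'n \<Rightarrow> 'a^'n \<Rightarrow> 'a" +
  fixes s y :: "'a^'n \<Rightarrow> 'a^'n" and U :: "('a^'n) set"
  assumes s: "lin s" "\<And>v. s (s v) = v" "\<And>u v. H (s u) v = H u (s v)"
    and y: "lin y" "\<And>u v. H (y u) v = - H u (y v)"
    and sy: "\<And>v. s (y v) = - y (s v)"
    and U: "vec.subspace U" "nondegenerate U" "U \<noteq> {0}"
    and sU: "\<And>u. u \<in> U \<Longrightarrow> s u \<in> U" and yU: "\<And>u. u \<in> U \<Longrightarrow> y u \<in> U"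
    and nilpotent_or_bijective: "\<And>p. qp p \<Longrightarrow> \<exists>N\<ge>1.
      (\<forall>u\<in>U. (poly_app (y \<circ> y) p ^^ N) u = 0) \<or> (\<forall>u\<in>U. (poly_app (y \<circ> y) p ^^ N) u = u)"
begin

lemma s_powers: "s ((y ^^ n) v) = (- 1) ^ n *s (y ^^ n) (s v)"
proof (induction n)
  case (Suc n)
  then show ?case by (simp add: sy vec.linear_scale[OF y(1)] flip: vec.scale_minus_left)
qed simp

lemma y_powers_U: "u \<in> U \<Longrightarrow> (y ^^ n) u \<in> U"
  by (induction n) (auto intro: yU)

lemma eigen_orthogonal:
  assumes "s a = \<epsilon> *s a" "s b = - \<epsilon> *s b" "\<epsilon> = 1 \<or> \<epsilon> = - 1"
  shows "H a b = 0"
proof -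
  have "H (s a) b = H a (s b)" by (rule s)
  then have "2 * H a b = 0"
    using assms minus_power_q[of 1] by (auto simp: H_scale H_scale_left H_minus)
  then show ?thesis by simp
qed

text \<open>For even \<open>i\<close> the operator \<open>y ^^ i\<close> is self-adjoint, so the
  value equals its own conjugate. For odd \<open>i\<close> it exchanges the two eigenspaces of
  \<open>s\<close>, which are orthogonal, so the value is 0.\<close>

lemma H_homogeneous_Fq:
  assumes "s a = \<epsilon> *s a" "\<epsilon> = 1 \<or> \<epsilon> = - 1"
  shows "H a ((y ^^ i) a) \<in> Fq"
proof (cases "even i")
  case True
  then show ?thesis
    using funpow_skew_adjoint[of y, OF y(2), of i a a] H_conj[of a "(y ^^ i) a"] 
    by (simp add: subfield_Fq_def)
next
  case False
  then have "s ((y ^^ i) a) = - \<epsilon> *s (y ^^ i) a"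
    using assms by (auto simp: s_powers vec.linear_neg[OF lin_funpow[OF y(1)]] vec.linear_scale[OF lin_funpow[OF y(1)]])
  then show ?thesis using eigen_orthogonal[OF assms(1) _ assms(2)] by simp
qed

text \<open>\<open>2 *s u\<close> is the sum of \<open>u + s u\<close> and \<open>u - s u\<close>,
  which lie in the two eigenspaces, so \<open>f\<close> cannot kill both.\<close>

lemma nonzero_on_eigenspace:
  assumes f: "lin f" and u: "u \<in> U" "f u \<noteq> 0"
  obtains \<epsilon> v where "\<epsilon> = 1 \<or> \<epsilon> = - 1" "v \<in> U" "s v = \<epsilon> *s v" "f v \<noteq> 0"
proof -
  have "f (u + s u) + f (u - s u) = 2 *s f u"
    by (simp add: vec.linear_add[OF f] vec.linear_diff[OF f] flip: vec.scale_left_distrib[of 1 1, simplified])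
  then have "f (u + s u) \<noteq> 0 \<or> f (u - s u) \<noteq> 0"
    using u(2) by (metis add.right_neutral two_neq_0 vec.scale_eq_0_iff)
  then show thesis
  proof
    assume "f (u + s u) \<noteq> 0"
    then show thesis
      using u(1) by (intro that[of 1 "u + s u"])
        (auto simp: vec.linear_add[OF s(1)] s(2) intro: vec.subspace_add[OF U(1)] sU)
  next
    assume "f (u - s u) \<noteq> 0"
    then show thesis
      using u(1) by (intro that[of "- 1" "u - s u"])
        (auto simp: vec.linear_diff[OF s(1)] s(2) intro: vec.subspace_diff[OF U(1)] sU)
  qed
qed

text \<open>Project a vector pairing nontrivially with \<open>a\<close> to the eigenspace of
  \<open>a\<close>; since \<open>s\<close> is self-adjoint this only doubles the pairing.\<close>

lemma pairing_on_eigenspace: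
  assumes a: "a \<in> U" "a \<noteq> 0" "s a = \<epsilon> *s a" and \<epsilon>: "\<epsilon> = 1 \<or> \<epsilon> = - 1"
  obtains b where "b \<in> U" "s b = \<epsilon> *s b" "H a b \<noteq> 0"
proof -
  obtain c where c: "c \<in> U" "H c a \<noteq> 0" using nondegenerateD[OF U(2) a(1)] a(2) by blast
  then have ac: "H a c \<noteq> 0" using H_eq_0_sym by blast
  have ee: "\<epsilon> * \<epsilon> = 1" using \<epsilon> by auto
  let ?b = "c + \<epsilon> *s s c"
  have "s ?b = \<epsilon> *s ?b"
    using ee by (simp add: vec.linear_add[OF s(1)] vec.linear_scale[OF s(1)] s(2) vec.scale_right_distrib)
  moreover have "?b \<in> U" using c by (intro vec.subspace_add[OF U(1)] vec.subspace_scale[OF U(1)] sU)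
  moreover have "H a ?b = 2 * H a c"
  proof -
    have "H a (s c) = H (s a) c" using s by simp
    also have "\<dots> = \<epsilon> * H a c" using \<epsilon> a(3) minus_power_q[of 1] by (auto simp: H_scale_left)
    finally show ?thesis using ee by (simp add: H_add H_scale algebra_simps)
  qed
  ultimately show thesis using that ac by simp
qed

lemma eigenspace_subspace: "vec.subspace {u\<in>U. s u = \<epsilon> *s u}"
  unfolding vec.subspace_def
  using vec.subspace_0[OF U(1)] vec.subspace_add[OF U(1)] vec.subspace_scale[OF U(1)]
  by (auto simp: vec.linear_0[OF s(1)] vec.linear_add[OF s(1)] vec.linear_scale[OF s(1)] 
      vec.scale_right_distrib mult.commute)

text \<open>A criterion for \<open>Fq[y] v + Fq[y] w\<close> to be a suitable subspace. The
  assumption \<open>top\<close> says that the pairing through the last power \<open>y ^^ m\<close>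
  is nondegenerate on the \<open>Fq\<close>-span of the generators; it concludes with a vector
  equation rather than zero coefficients, so \<open>w = 0\<close> covers the case of a single
  generator.\<close>

lemma nilpotent_generated:
  assumes vw: "v \<in> U" "w \<in> U" "v \<noteq> 0" "s v = \<epsilon> *s v" "s w = \<delta> *s w"
    and signs: "\<epsilon> \<in> Fq" "\<delta> \<in> Fq"
    and real: "\<And>a b i. a \<in> {v, w} \<Longrightarrow> b \<in> {v, w} \<Longrightarrow> H a ((y ^^ i) b) \<in> Fq"
    and nil: "\<And>u. u \<in> U \<Longrightarrow> (y ^^ Suc m) u = 0"
    and top: "\<And>\<alpha> \<beta>. \<alpha> \<in> Fq \<Longrightarrow> \<beta> \<in> Fq \<Longrightarrow> H v ((y ^^ m) (\<alpha> *s v + \<beta> *s w)) = 0 \<Longrightarrow>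
      H w ((y ^^ m) (\<alpha> *s v + \<beta> *s w)) = 0 \<Longrightarrow> \<alpha> *s v + \<beta> *s w = 0"
  shows "\<exists>W. quadratic_Fq_subspace W \<and> W \<noteq> {0} \<and> W \<subseteq> U \<and> s ` W \<subseteq> W \<and> y ` W \<subseteq> W"
proof -
  note yl = y(1)
  note ynl = lin_funpow[OF y(1)]
  define W where "W = {poly_app y f v + poly_app y g w |f g. qp f \<and> qp g}"
  have WI: "poly_app y f v + poly_app y g w \<in> W" if "qp f" "qp g" for f g
    using that unfolding W_def by blast
  have v: "v \<in> W" and w: "w \<in> W" using WI[of 1 0] WI[of 0 1] y by auto
  have WU: "W \<subseteq> U"
    unfolding W_def using vw
    by (auto intro!: vec.subspace_add[OF U(1)] poly_app_mem_subspace[OF y(1) U(1)] yU)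
  have "Fq_subspace W"
    unfolding Fq_subspace_def
  proof (intro conjI ballI)
    show "0 \<in> W" using WI[of 0 0] by simp
    fix a b assume "a \<in> W" "b \<in> W"
    then obtain f g f' g' where *: "a = poly_app y f v + poly_app y g w" "qp f" "qp g"
      "b = poly_app y f' v + poly_app y g' w" "qp f'" "qp g'" unfolding W_def by blast
    then have "a + b = poly_app y (f + f') v + poly_app y (g + g') w"
      by (simp add: poly_app_add[OF yl])
    then show "a + b \<in> W" using WI[of "f + f'" "g + g'"] * by (simp add: qp_add)
  next
    fix c a assume "c \<in> Fq" "a \<in> W"
    then obtain f g where *: "a = poly_app y f v + poly_app y g w" "qp f" "qp g"
      unfolding W_def by blast
    then have "c *s a = poly_app y (smult c f) v + poly_app y (smult c g) w"
      by (simp add: poly_app_smult[OF yl] vec.scale_right_distrib)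
    then show "c *s a \<in> W" using WI[of "smult c f" "smult c g"] * \<open>c \<in> Fq\<close> by (simp add: qp_smult)
  qed
  moreover have real2: "H a ((y ^^ i) (poly_app y g b)) \<in> Fq"
    if "qp g" "a \<in> {v, w}" "b \<in> {v, w}" for a b g i
    using that(1)
  proof (induction g arbitrary: i rule: qp_induct)
    case 0
    then show ?case by (simp add: vec.linear_0[OF ynl])
  next
    case (pCons c p)
    have "(y ^^ i) (y (poly_app y p b)) = (y ^^ Suc i) (poly_app y p b)"
      by (simp add: funpow_swap1)
    then show ?case
      using pCons(1) pCons.IH[of "Suc i"] real[OF that(2,3), of i] yl
      by (auto simp: vec.linear_add[OF ynl] vec.linear_scale[OF ynl] H_add H_scale simp del: funpow.simps)
  qed
  \<comment> \<open>Skew-adjointness moves each \<open>y\<close> from the left argument to the right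
    one, where it becomes the factor \<open>X\<close> of \<open>pCons 0 g\<close>, up to
    sign.\<close>
  have real3: "H (poly_app y f a) (poly_app y g b) \<in> Fq"
    if "qp f" "qp g" "a \<in> {v, w}" "b \<in> {v, w}" for a b f g
    using that(1,2)
  proof (induction f arbitrary: g rule: qp_induct)
    case (pCons c p)
    have "H (y (poly_app y p a)) (poly_app y g b) = - H (poly_app y p a) (poly_app y (pCons 0 g) b)"
      using yl by (simp add: y(2))
    then show ?case
      using pCons.hyps(1) pCons.IH[of "pCons 0 g"] pCons.prems real2[OF pCons.prems that(3,4), of 0] yl
      by (simp add: H_add_left H_scale_left_Fq) (intro Fq_add Fq_diff Fq_mult; simp)
  qed simp
  then have "\<forall>a\<in>W. \<forall>b\<in>W. H a b \<in> Fq"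
    unfolding W_def by (auto simp: H_add H_add_left intro!: Fq_add)
  moreover have yW: "y a \<in> W" if "a \<in> W" for a
  proof -
    from that obtain f g where *: "a = poly_app y f v + poly_app y g w" "qp f" "qp g"
      unfolding W_def by blast
    have "y a = poly_app y (pCons 0 f) v + poly_app y (pCons 0 g) w"
      using yl by (simp add: * vec.linear_add[OF yl])
    then show ?thesis using WI[of "pCons 0 f" "pCons 0 g"] * by simp
  qed
  then have ynW: "(y ^^ n) a \<in> W" if "a \<in> W" for a n
    using that by (induction n) auto
  \<comment> \<open>Moving \<open>s\<close> past each \<open>y\<close> changes the sign, so
    \<open>f'\<close> is \<open>\<gamma>\<close> times \<open>f(-X)\<close>.\<close>
  have spoly: "\<exists>f'. qp f' \<and> s (poly_app y f a) = poly_app y f' a"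
    if "qp f" "s a = \<gamma> *s a" "\<gamma> \<in> Fq" for f a \<gamma>
    using that(1)
  proof (induction f rule: qp_induct)
    case 0
    then show ?case using vec.linear_0[OF s(1)] by (intro exI[of _ 0]) auto
  next
    case (pCons c p)
    then obtain f' where f': "qp f'" "s (poly_app y p a) = poly_app y f' a" by blast
    have "s (poly_app y (pCons c p) a) = poly_app y (pCons (c * \<gamma>) (- f')) a"
      using yl f' that(2)
      by (simp add: vec.linear_add[OF s(1)] vec.linear_scale[OF s(1)] sy poly_app_minus[OF yl]
        vec.linear_neg[OF yl])
    then show ?case using f'(1) pCons(1) that(3) by (intro exI[of _ "pCons (c * \<gamma>) (- f')"]) auto
  qed
  have "s a \<in> W" if "a \<in> W" for a
  proof -
    from that obtain f g where *: "a = poly_app y f v + poly_app y g w" "qp f" "qp g"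
      unfolding W_def by blast
    obtain f' where "qp f'" "s (poly_app y f v) = poly_app y f' v"
      using spoly[OF *(2) vw(4) signs(1)] by blast
    moreover obtain g' where "qp g'" "s (poly_app y g w) = poly_app y g' w"
      using spoly[OF *(3) vw(5) signs(2)] by blast
    ultimately show ?thesis using WI[of f' g'] by (simp add: * vec.linear_add[OF s(1)])
  qed
  moreover have "nondegenerate W"
  proof -
    txt \<open>The radical is \<open>y\<close>-stable, so a power of \<open>y\<close> moves the lowest coefficients of an element of it
      to degree \<open>m\<close>, where \<open>top\<close> kills them.\<close>
    define R where "R = {a \<in> W. \<forall>b\<in>W. H b a = 0}"
    have yR: "y a \<in> R" if "a \<in> R" for a
    proof -
      have "H b (y a) = - H (y b) a" for b using y(2)[of b a] by simp
      then show ?thesis using that yW by (auto simp: R_def)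
    qed
    have ynR: "(y ^^ n) a \<in> R" if "a \<in> R" for a n
      using that by (induction n) (auto intro: yR)
    \<comment> \<open>The radical meets the image of \<open>W\<close> under
      \<open>y ^^ (Suc m - i)\<close> only in 0. For \<open>i = 0\<close> that image is zero;
      \<open>i = Suc m\<close> is the full claim.\<close>
    have descent: "a = 0" if "a \<in> R" "a = (y ^^ (Suc m - i)) (poly_app y f v + poly_app y g w)" 
      "qp f" "qp g" "i \<le> Suc m" for i a f g
      using that
    proof (induction i arbitrary: a f g)
      case 0
      then have "poly_app y f v + poly_app y g w \<in> U" using WI WU by blast
      then show ?case using 0 nil by simp
    next
      case (Suc i)
      define j where "j = Suc m - Suc i"
      have j: "j \<le> m" "Suc m - i = Suc j" "i = m - j" using Suc.prems by (auto simp: j_def)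
      obtain \<alpha> f' where f: "f = pCons \<alpha> f'" by (cases f)
      obtain \<beta> g' where g: "g = pCons \<beta> g'" by (cases g)
      let ?t = "\<alpha> *s v + \<beta> *s w" and ?r = "poly_app y f' v + poly_app y g' w"
      have qp: "\<alpha> \<in> Fq" "\<beta> \<in> Fq" "qp f'" "qp g'" using Suc.prems f g by auto
      have split: "poly_app y f v + poly_app y g w = ?t + y ?r"
        using yl by (simp add: f g vec.linear_add[OF yl] algebra_simps)
      have rU: "?r \<in> U" using WI[OF qp(3,4)] WU by blast
      have "(y ^^ (m - j)) a = (y ^^ m) (?t + y ?r)"
        unfolding Suc.prems(2) split using j by (simp flip: j_def funpow_add[THEN fun_cong, unfolded o_apply])
      also have "\<dots> = (y ^^ m) ?t + (y ^^ Suc m) ?r"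
        by (simp add: vec.linear_add[OF ynl] funpow_swap1[symmetric] vec.linear_add[OF yl])
      finally have "(y ^^ (m - j)) a = (y ^^ m) ?t" using nil[OF rU] by simp
      then have "(y ^^ m) ?t \<in> R" using ynR[OF Suc.prems(1)] by metis
      then have "?t = 0" using top[OF qp(1,2)] v w by (auto simp: R_def)
      then have "a = (y ^^ (Suc m - i)) ?r"
        using Suc.prems(2) split j by (simp add: j_def[symmetric] funpow_swap1)
      then show ?case using Suc.IH[of a f' g'] Suc.prems qp by simp
    qed
    show ?thesis
      unfolding nondegenerate_def
    proof (intro ballI impI)
      fix a assume a: "a \<in> W" "\<forall>b\<in>W. H b a = 0"
      then obtain f g where *: "a = poly_app y f v + poly_app y g w" "qp f" "qp g"
        unfolding W_def by blast
      show "a = 0" using descent[of a "Suc m" f g] a * by (simp add: R_def)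
    qed
  qed
  moreover have "W \<noteq> {0}" using v vw(3) by blast
  ultimately show ?thesis
    using WU yW unfolding quadratic_Fq_subspace_def by blast
qed


text \<open>Let \<open>m\<close> be the last exponent with \<open>y ^^ m\<close> nonzero on
  \<open>U\<close>. For even \<open>m\<close>, \<open>y ^^ m\<close> is self-adjoint and preserves
  the eigenspaces of \<open>s\<close>, so one eigenvector anisotropic for it generates the subspace.
  For odd \<open>m\<close> it exchanges the eigenspaces, and a pair of generators \<open>a\<close>,
  \<open>w\<close> with opposite signs is needed, normalised so that all their mutual pairings lie
  in \<open>Fq\<close>.\<close>

lemma nilpotent_case:
  assumes N: "\<And>u. u \<in> U \<Longrightarrow> ((y \<circ> y) ^^ N) u = 0"
  shows "\<exists>W. quadratic_Fq_subspace W \<and> W \<noteq> {0} \<and> W \<subseteq> U \<and> s ` W \<subseteq> W \<and> y ` W \<subseteq> W"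
proof -
  note ynl = lin_funpow[OF y(1)]
  define Z where "Z n \<longleftrightarrow> (\<forall>u\<in>U. (y ^^ n) u = 0)" for n
  have "y ^^ (2 * N) = (y \<circ> y) ^^ N"
    using funpow_mult[of N 2 y] by (simp add: numeral_2_eq_2)
  then have "Z (2 * N)" using N by (simp add: Z_def)
  moreover have "\<not> Z 0"
    using U(3) vec.subspace_0[OF U(1)] by (auto simp: Z_def)
  ultimately obtain m where "\<not> Z m" and Zm: "Z (Suc m)"
    using ex_least_nat_less[of Z "2 * N"] by blast
  then obtain u0 where u0: "u0 \<in> U" "(y ^^ m) u0 \<noteq> 0" by (auto simp: Z_def)
  have nil: "(y ^^ n) u = 0" if "u \<in> U" "n > m" for u n
  proof -
    have "(y ^^ n) u = (y ^^ (n - Suc m)) ((y ^^ Suc m) u)"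
      using that(2) by (simp flip: funpow_add[THEN fun_cong, unfolded o_apply] funpow.simps)
    then show ?thesis using Zm that(1) by (simp add: Z_def vec.linear_0[OF ynl] del: funpow.simps)
  qed
  obtain \<epsilon> a where \<epsilon>: "\<epsilon> = 1 \<or> \<epsilon> = - 1" and a: "a \<in> U" "s a = \<epsilon> *s a" "(y ^^ m) a \<noteq> 0"
    using nonzero_on_eigenspace[OF ynl u0] .
  have s_ya: "s ((y ^^ m) a) = ((- 1) ^ m * \<epsilon>) *s (y ^^ m) a"
    by (simp add: s_powers a vec.linear_scale[OF ynl])
  have \<epsilon>m: "(- 1) ^ m * \<epsilon> = 1 \<or> (- 1) ^ m * \<epsilon> = - 1"
    using \<epsilon> by (cases "even m") auto
  obtain b where b: "b \<in> U" "s b = ((- 1) ^ m * \<epsilon>) *s b" "H ((y ^^ m) a) b \<noteq> 0"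
    using pairing_on_eigenspace[OF y_powers_U[OF a(1)] a(3) s_ya \<epsilon>m] .
  have \<epsilon>_Fq: "\<epsilon> \<in> Fq" "- \<epsilon> \<in> Fq" using \<epsilon> by auto
  show ?thesis
  proof (cases "even m")
    case True
    let ?T = "{u\<in>U. s u = \<epsilon> *s u}"
    have adj: "H ((y ^^ m) u) v = H u ((y ^^ m) v)" for u v
      using funpow_skew_adjoint[of y, OF y(2), of m u v] True by simp
    have "b \<in> ?T" "a \<in> ?T" "H a ((y ^^ m) b) \<noteq> 0" using b a True adj by auto
    then obtain v where v: "v \<in> ?T" "H v ((y ^^ m) v) \<noteq> 0"
      using exists_anisotropic[OF eigenspace_subspace ynl adj] by blast
    show ?thesis
    proof (rule nilpotent_generated[of v 0 \<epsilon> \<epsilon> m])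
      show "v \<noteq> 0" using v(2) by auto
      show "H a ((y ^^ i) b) \<in> Fq" if "a \<in> {v, 0}" "b \<in> {v, 0}" for a b i
        using that H_homogeneous_Fq[of v \<epsilon> i] v(1) \<epsilon> by (auto simp: vec.linear_0[OF ynl])
      show "\<alpha> *s v + \<beta> *s 0 = 0" if "H v ((y ^^ m) (\<alpha> *s v + \<beta> *s 0)) = 0" for \<alpha> \<beta>
        using that v(2) by (simp add: vec.linear_scale[OF ynl] H_scale)
    qed (use v \<epsilon>_Fq nil vec.subspace_0[OF U(1)] vec.linear_0[OF s(1)] in \<open>auto simp del: funpow.simps\<close>)
  next
    case False
    have adjm: "H ((y ^^ m) u) v = - H u ((y ^^ m) v)" for u v
      using funpow_skew_adjoint[of y, OF y(2), of m u v] False by simp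
    \<comment> \<open>Induction on the number \<open>j\<close> of exponents just below
      \<open>m\<close> at which the pairing of \<open>a\<close> with \<open>(y ^^ i) w\<close> has
      been made to vanish.\<close>
    have "\<exists>w\<in>U. s w = - \<epsilon> *s w \<and> H a ((y ^^ m) w) = 1 \<and> (\<forall>i. m \<le> i + j \<longrightarrow> i < m \<longrightarrow> H a ((y ^^ i) w) = 0)"
      for j
    proof (induction j)
      case 0
      define c where "c = H a ((y ^^ m) b)"
      have "c \<noteq> 0" using b(3) adjm by (auto simp: c_def)
      then show ?case using b False
        by (intro bexI[of _ "(1 / c) *s b"] conjI)
          (auto simp: vec.linear_scale[OF s(1)] vec.linear_scale[OF ynl] H_scale c_def mult.commute
            intro: vec.subspace_scale[OF U(1)])
    next
      case (Suc j)
      then obtain w where w: "w \<in> U" "s w = - \<epsilon> *s w" "H a ((y ^^ m) w) = 1"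
        "\<And>i. m \<le> i + j \<Longrightarrow> i < m \<Longrightarrow> H a ((y ^^ i) w) = 0" by (elim bexE conjE) simp
      show ?case
      proof (cases "j < m \<and> H a ((y ^^ (m - Suc j)) w) \<noteq> 0")
        case F: False
          have "H a ((y ^^ i) w) = 0" if i: "m \<le> i + Suc j" "i < m" for i
          proof (cases "m \<le> i + j")
            case True
            then show ?thesis using w(4) i(2) by blast
          next
            case False
            then have "j < m" "i = m - Suc j" using i by auto
            then show ?thesis using F by blast
          qed
        then show ?thesis using w by blast
      next
        \<comment> \<open>The pairing at \<open>l = m - Suc j\<close> is removed by subtracting a
          multiple of \<open>(y ^^ Suc j) w\<close>, whose pairing at \<open>l\<close> is the
          normalised value at \<open>m\<close>. Pairings at exponents between \<open>l\<close> and
          \<open>m\<close> are unaffected because \<open>y\<close> vanishes beyond power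
          \<open>m\<close>.\<close>
        case True
        define l where "l = m - Suc j"
        define c where "c = H a ((y ^^ l) w)"
        have l: "l + Suc j = m" using True by (simp add: l_def)
        \<comment> \<open>An even \<open>l\<close> would leave \<open>(y ^^ l) w\<close> in the
          eigenspace orthogonal to \<open>a\<close>. Since \<open>m\<close> is odd, it follows that
          \<open>Suc j\<close> is even and the correction stays in the eigenspace of
          \<open>w\<close>.\<close>
        have "odd l"
        proof
          assume "even l"
          then have "s ((y ^^ l) w) = - \<epsilon> *s (y ^^ l) w"
            by (simp add: s_powers w(2) vec.linear_scale[OF ynl] del: vec.scale_minus_left)
          then have "c = 0" unfolding c_def using eigen_orthogonal[OF a(2) _ \<epsilon>] by blast
          then show False using True by (simp add: c_def l_def)
        qed
        then have "odd j" using False l by presburger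
        define w' where "w' = w - c *s (y ^^ Suc j) w"
        have "s ((y ^^ Suc j) w) = - \<epsilon> *s (y ^^ Suc j) w"
          using \<open>odd j\<close> by (simp add: s_powers w(2) vec.linear_scale[OF ynl] del: vec.scale_minus_left funpow.simps)
        then have "s w' = - \<epsilon> *s w'"
          by (simp add: w'_def vec.linear_diff[OF s(1)] vec.linear_scale[OF s(1)] w(2)
            vec.scale_right_diff_distrib mult.commute del: funpow.simps)
        moreover have "w' \<in> U"
          unfolding w'_def using w(1) by (intro vec.subspace_diff[OF U(1)] vec.subspace_scale[OF U(1)] y_powers_U)
        moreover have Hw': "H a ((y ^^ i) w') = H a ((y ^^ i) w) - c * H a ((y ^^ (i + Suc j)) w)" for i
          by (simp only: w'_def vec.linear_diff[OF ynl] vec.linear_scale[OF ynl] H_diff H_scale funpow_add o_apply)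
        moreover have "H a ((y ^^ m) w') = 1"
          using nil[OF w(1), of "m + Suc j"] by (simp add: Hw' w(3) del: funpow.simps)
        moreover have "H a ((y ^^ i) w') = 0" if "m \<le> i + Suc j" "i < m" for i
        proof (cases "i = l")
          case True
          show ?thesis unfolding Hw' True l by (simp add: w(3) c_def)
        next
          case False
          then show ?thesis
            unfolding Hw' using nil[OF w(1), of "i + Suc j"] w(4)[of i] that l by (simp del: funpow.simps)
        qed
        ultimately show ?thesis by blast
      qed
    qed
    from this[of m] obtain w where w: "w \<in> U" "s w = - \<epsilon> *s w" "H a ((y ^^ m) w) = 1"
      "\<And>i. i < m \<Longrightarrow> H a ((y ^^ i) w) = 0" by auto
    have aw: "H a ((y ^^ i) w) \<in> Fq" for i
      using w(3) w(4)[of i] nil[OF w(1), of i] by (cases i m rule: linorder_cases) auto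
    have wa: "H w ((y ^^ i) a) \<in> Fq" for i
    proof -
      have "H ((y ^^ i) a) w = (- 1) ^ i * H a ((y ^^ i) w)"
        by (rule funpow_skew_adjoint) (rule y)
      then have "H ((y ^^ i) a) w \<in> Fq" using aw[of i] by (cases "even i") auto
      moreover have "H w ((y ^^ i) a) = H ((y ^^ i) a) w ^ q" by (simp add: H_conj)
      ultimately show ?thesis by (simp add: subfield_Fq_def)
    qed
    have m\<epsilon>: "- \<epsilon> = 1 \<or> - \<epsilon> = - 1" using \<epsilon> by auto
    have Haa: "H a ((y ^^ m) a) = 0"
      using eigen_orthogonal[OF a(2) _ \<epsilon>] s_ya False by auto
    have Hww: "H w ((y ^^ m) w) = 0"
      using eigen_orthogonal[OF w(2) _ m\<epsilon>] False by (simp add: s_powers w(2) vec.linear_scale[OF ynl] vec.linear_neg[OF ynl])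
    have Hwa: "H w ((y ^^ m) a) \<noteq> 0"
      using w(3) adjm[of a w] H_eq_0_sym[of w "(y ^^ m) a"] by auto
    show ?thesis
    proof (rule nilpotent_generated[of a w \<epsilon> "- \<epsilon>" m])
      show "a \<noteq> 0" using w(3) by auto
      show "H a' ((y ^^ i) b) \<in> Fq" if "a' \<in> {a, w}" "b \<in> {a, w}" for a' b i
        using that H_homogeneous_Fq[OF a(2) \<epsilon>] H_homogeneous_Fq[OF w(2) m\<epsilon>] aw wa by auto
      show "\<alpha> *s a + \<beta> *s w = 0"
        if "H a ((y ^^ m) (\<alpha> *s a + \<beta> *s w)) = 0" "H w ((y ^^ m) (\<alpha> *s a + \<beta> *s w)) = 0" for \<alpha> \<beta>
        using that Haa Hww Hwa w(3)
        by (simp add: vec.linear_scale[OF ynl] vec.linear_add[OF ynl] H_scale H_add)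
    qed (use a w \<epsilon>_Fq nil in \<open>auto simp del: funpow.simps\<close>)
  qed
qed

text \<open>On \<open>U\<close>, every polynomial over \<open>Fq\<close> in
  \<open>x = y \<circ> y\<close> is invertible or a multiple of \<open>P\<close>. Hence the last
  nonzero power \<open>P ^ K\<close> is a multiple of every nonzero element, and a single nonzero
  value \<open>H v (A (P ^ K) v)\<close> forces the form to be nondegenerate on
  \<open>Fq[y] v\<close>.\<close>

lemma bijective_case:
  assumes N: "N \<ge> 1" "\<And>u. u \<in> U \<Longrightarrow> ((y \<circ> y) ^^ N) u = u"
  shows "\<exists>W. quadratic_Fq_subspace W \<and> W \<noteq> {0} \<and> W \<subseteq> U \<and> s ` W \<subseteq> W \<and> y ` W \<subseteq> W"
proof -
  define x where "x = y \<circ> y"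
  define A where "A = poly_app x"
  have xl: "lin x" unfolding x_def by (rule Vector_Spaces.linear_compose[OF y(1) y(1)])
  have Al: "lin (A p)" for p unfolding A_def by (rule lin_poly_app[OF xl])
  have A_mult: "A (p * r) v = A p (A r v)" for p r v by (simp add: A_def poly_app_mult[OF xl])
  have A_power: "A (p ^ n) v = (A p ^^ n) v" for p n v by (simp add: A_def poly_app_power[OF xl])
  have A_add: "A (p + r) v = A p v + A r v" for p r v by (simp add: A_def poly_app_add[OF xl])
  have x_adj: "H (x u) v = H u (x v)" for u v by (simp add: x_def y(2))
  have A_adj: "H (A p u) v = H u (A p v)" if "qp p" for p u v
    unfolding A_def by (rule poly_app_adjoint[OF xl x_adj that])
  have A_s: "A p (s v) = s (A p v)" for p v
    unfolding A_def by (rule poly_app_commute[OF xl s(1)]) (simp add: x_def sy vec.linear_neg[OF y(1)])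
  have A_y: "A p (y v) = y (A p v)" for p v
    unfolding A_def by (rule poly_app_commute[OF xl y(1)]) (simp add: x_def)
  have A_U: "A p u \<in> U" if "u \<in> U" for p u
    unfolding A_def by (rule poly_app_mem_subspace[OF xl U(1) _ that]) (simp add: x_def yU)
  have A_1: "A 1 v = v" for v by (simp add: A_def xl)
  have A_X: "A (monom 1 n) v = (x ^^ n) v" for n v by (simp add: A_def poly_app_X_power[OF xl])
  txt \<open>For \<open>Q\<close> such that \<open>f \<mapsto> f\<^sup>Q\<close> is idempotent on the algebra generated by \<open>x\<close>, every nilpotent
    element of that algebra is a multiple of \<open>x - x\<^sup>Q\<close>.\<close>
  define \<Theta> :: "('a^'n \<Rightarrow> 'a^'n) \<Rightarrow> ('a^'n \<Rightarrow> 'a^'n)" where "\<Theta> f = f ^^ q" for f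
  have \<Theta>: "(\<Theta> ^^ k) f = f ^^ (q ^ k)" for k f
    by (induction k) (auto simp: \<Theta>_def funpow_mult mult.commute)
  obtain k where k: "k \<ge> 1" "\<And>f. (\<Theta> ^^ k) ((\<Theta> ^^ k) f) = (\<Theta> ^^ k) f"
    by (rule funpow_idempotent_exists[of \<Theta>]) blast
  define Q where "Q = q ^ k"
  have Q1: "Q > 1" unfolding Q_def using q_gt_1 k(1) by (intro one_less_power) auto
  have xQ: "x ^^ (Q * Q) = x ^^ Q" using k(2)[of x] by (simp add: \<Theta> Q_def funpow_mult)
  define P :: "'a poly" where "P = monom 1 1 - monom 1 Q"
  have P: "qp P" by (auto simp: P_def)
  have frob: "A (f ^ Q) v = poly_app (x ^^ Q) f v" if "qp f" for f v
  proof -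
    have "poly_app x (monom 1 Q) = x ^^ Q" using A_X by (simp add: A_def fun_eq_iff)
    then show ?thesis
      unfolding A_def Q_def qp_frobenius[OF that] poly_app_pcompose[OF xl] by (simp add: Q_def)
  qed
  \<comment> \<open>In terms of operators:
    \<open>f^(Q*Q)(x) = f(x^(Q*Q)) = f(x^Q) = f^Q(x)\<close>.\<close>
  have frob2: "A ((f ^ Q) ^ Q) v = A (f ^ Q) v" if "qp f" for f v
  proof -
    have "poly_app x (monom 1 (Q * Q)) = x ^^ (Q * Q)" using A_X by (simp add: A_def fun_eq_iff)
    moreover have "(f ^ Q) ^ Q = f ^ (q ^ (k + k))" by (simp add: Q_def power_add power_mult)
    moreover have "q ^ (k + k) = Q * Q" by (simp add: Q_def power_add)
    ultimately show ?thesis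
      unfolding frob[OF that]
      using qp_frobenius[OF that, of "k + k"] poly_app_pcompose[OF xl, of f] 
      by (simp add: A_def xQ)
  qed
  have P_nil: "A (P ^ Q) v = 0" for v
  proof -
    have l: "lin (x ^^ Q)" by (rule lin_funpow[OF xl])
    have "poly_app (x ^^ Q) P v = (x ^^ Q) v - ((x ^^ Q) ^^ Q) v"
      unfolding P_def poly_app_diff[OF l] poly_app_X_power[OF l] by simp
    also have "\<dots> = 0" by (simp add: funpow_mult xQ)
    finally show ?thesis by (simp add: frob[OF P])
  qed
  have unit_or_multiple: "(\<exists>M\<ge>1. \<forall>u\<in>U. A (f ^ M) u = u) \<or> (\<exists>d. qp d \<and> (\<forall>v\<in>U. A f v = A (P * d) v))"
    if f: "qp f" for f
  proof -
    obtain M where "M \<ge> 1" and M: "(\<forall>u\<in>U. A (f ^ M) u = 0) \<or> (\<forall>u\<in>U. A (f ^ M) u = u)"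
      using nilpotent_or_bijective[OF f] unfolding A_power by (auto simp: A_def x_def)
    show ?thesis
    proof (cases "\<forall>u\<in>U. A (f ^ M) u = 0")
      case True
      \<comment> \<open>By \<open>frob2\<close>, \<open>f ^ Q\<close> acts like arbitrarily high
        powers of \<open>f\<close>. For nilpotent \<open>f\<close> it therefore acts as zero, and
        \<open>f\<close> acts as \<open>f - f ^ Q\<close>, which is divisible by
        \<open>P\<close>.\<close>
      have iter: "A ((f ^ Q) ^ (Q ^ j)) v = A (f ^ Q) v" for j v
      proof (induction j arbitrary: v)
        case (Suc j)
        have e: "A ((f ^ Q) ^ Q) = A (f ^ Q)" using frob2[OF f] by (simp add: fun_eq_iff)
        have "A ((f ^ Q) ^ (Q ^ Suc j)) v = A (((f ^ Q) ^ Q) ^ (Q ^ j)) v" by (simp add: power_mult)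
        also have "\<dots> = A ((f ^ Q) ^ (Q ^ j)) v" by (subst (1 2) A_power) (simp only: e)
        finally show ?case using Suc by simp
      qed simp
      have "Q * Q ^ M \<ge> M" 
      proof -
        have "M < Q ^ M" using power_gt_expt[of Q M] Q1 by simp
        also have "\<dots> \<le> Q * Q ^ M" using Q1 by simp
        finally show ?thesis by simp
      qed
      then have "(f ^ Q) ^ (Q ^ M) = f ^ (Q * Q ^ M - M) * f ^ M"
        by (simp flip: power_add power_mult)
      then have fQ: "A (f ^ Q) u = 0" if "u \<in> U" for u
        using True that iter[of M u] vec.linear_0[OF Al] by (simp add: A_mult)
      obtain d where d: "qp d" "f - f ^ Q = P * d"
        using qp_frobenius_diff[OF f, of k] by (auto simp: P_def Q_def)
      have "f = f ^ Q + P * d" using d(2) by (simp add: algebra_simps)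
      then have "A f u = A (P * d) u" if "u \<in> U" for u using fQ[OF that] A_add by (metis add_0)
      then show ?thesis using d(1) by blast
    next
      case False
      then show ?thesis using M \<open>M \<ge> 1\<close> by blast
    qed
  qed
  define Z where "Z n \<longleftrightarrow> (\<forall>u\<in>U. A (P ^ n) u = 0)" for n
  have "Z Q" using P_nil by (simp add: Z_def)
  moreover have "\<not> Z 0" using U(3) vec.subspace_0[OF U(1)] by (auto simp: Z_def A_1)
  ultimately obtain K where "\<not> Z K" and ZK: "Z (Suc K)"
    using ex_least_nat_less[of Z Q] by blast
  then obtain u0 where u0: "u0 \<in> U" "A (P ^ K) u0 \<noteq> 0" by (auto simp: Z_def)
  \<comment> \<open>Downward induction on the power of \<open>P\<close> in front of
    \<open>f\<close>: a non-invertible \<open>f\<close> is replaced by \<open>P * d\<close>, which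
    moves one factor \<open>P\<close> to the front, until the power \<open>Suc K\<close> kills
    everything.\<close>
  have socle: "(\<forall>u\<in>U. A (P ^ (Suc K - i) * f) u = 0) \<or>
      (\<exists>g. qp g \<and> (\<forall>u\<in>U. A (P ^ (Suc K - i) * f * g) u = A (P ^ K) u))"
    if "i \<le> Suc K" "qp f" for i f
    using that
  proof (induction i arbitrary: f)
    case 0
    have "A (P ^ Suc K * f) u = A (P ^ Suc K) (A f u)" for u by (rule A_mult)
    then show ?case using ZK A_U by (simp add: Z_def del: power_Suc)
  next
    case (Suc i)
    define j where "j = Suc K - Suc i"
    have j: "Suc K - i = Suc j" "j \<le> K" using Suc.prems by (auto simp: j_def)
    from unit_or_multiple[OF Suc.prems(2)] show ?case
    proof
      assume "\<exists>M\<ge>1. \<forall>u\<in>U. A (f ^ M) u = u"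
      then obtain M where M: "M \<ge> 1" "\<And>u. u \<in> U \<Longrightarrow> A (f ^ M) u = u" by blast
      \<comment> \<open>\<open>f ^ (M - 1)\<close> inverts \<open>f\<close> on \<open>U\<close>, and
        the remaining factor raises \<open>P ^ j\<close> to \<open>P ^ K\<close>.\<close>
      have "P ^ j * f * (f ^ (M - 1) * P ^ (K - j)) = (P ^ j * P ^ (K - j)) * (f * f ^ (M - 1))"
        by (simp add: mult_ac)
      also have "\<dots> = P ^ K * f ^ M" using M(1) j(2) by (simp flip: power_add power_Suc)
      finally have "A (P ^ j * f * (f ^ (M - 1) * P ^ (K - j))) u = A (P ^ K) u" if "u \<in> U" for u
        using M(2)[OF that] by (simp add: A_mult)
      moreover have "qp (f ^ (M - 1) * P ^ (K - j))" using P Suc.prems by auto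
      ultimately show ?thesis unfolding j_def by blast
    next
      assume "\<exists>d. qp d \<and> (\<forall>v\<in>U. A f v = A (P * d) v)"
      then obtain d where d: "qp d" "\<And>v. v \<in> U \<Longrightarrow> A f v = A (P * d) v" by blast
      have e: "A (P ^ j * f) u = A (P ^ Suc j * d) u" if "u \<in> U" for u
      proof -
        have "A (P ^ j * f) u = A (P ^ j * (P * d)) u"
          unfolding A_mult[of "P ^ j"] d(2)[OF that] ..
        then show ?thesis by (simp add: mult_ac)
      qed
      have e': "A (P ^ j * f * g) u = A (P ^ Suc j * d * g) u" if "u \<in> U" for u g
        using e[OF A_U[OF that]] by (metis A_mult)
      show ?thesis
        using Suc.IH[OF _ d(1)] Suc.prems(1) e e' unfolding j j_def[symmetric] by auto
    qed
  qed
  have socle0: "(\<forall>u\<in>U. A f u = 0) \<or> (\<exists>g. qp g \<and> (\<forall>u\<in>U. A (f * g) u = A (P ^ K) u))" if "qp f" for f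
    using socle[of "Suc K" f] that by simp
  obtain \<epsilon> a where \<epsilon>: "\<epsilon> = 1 \<or> \<epsilon> = - 1" and a: "a \<in> U" "s a = \<epsilon> *s a" "A (P ^ K) a \<noteq> 0"
    using nonzero_on_eigenspace[OF Al u0] .
  have s_A: "s (A f v) = \<epsilon> *s A f v" if "s v = \<epsilon> *s v" for f v
    using that by (simp add: vec.linear_scale[OF Al] flip: A_s)
  obtain b where b: "b \<in> U" "s b = \<epsilon> *s b" "H (A (P ^ K) a) b \<noteq> 0"
    using pairing_on_eigenspace[OF A_U[OF a(1)] a(3) s_A[OF a(2)] \<epsilon>] .
  let ?T = "{u\<in>U. s u = \<epsilon> *s u}"
  have adj: "H (A (P ^ K) u) v = H u (A (P ^ K) v)" for u v using P by (intro A_adj) auto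
  have "b \<in> ?T" "a \<in> ?T" "H a (A (P ^ K) b) \<noteq> 0" using b a adj by auto
  then obtain v where v: "v \<in> U" "s v = \<epsilon> *s v" "H v (A (P ^ K) v) \<noteq> 0"
    using exists_anisotropic[OF eigenspace_subspace Al adj] by blast
  \<comment> \<open>This is \<open>Fq[y] v\<close>, split into its even and odd parts in
    \<open>y\<close>; they lie in opposite eigenspaces of \<open>s\<close> and so are
    orthogonal.\<close>
  define W where "W = {A f v + y (A g v) |f g. qp f \<and> qp g}"
  have WI: "A f v + y (A g v) \<in> W" if "qp f" "qp g" for f g
    using that unfolding W_def by blast
  have A_0: "A 0 u = 0" for u by (simp add: A_def)
  have A_smult: "A (smult c p) u = c *s A p u" for c p u by (simp add: A_def poly_app_smult[OF xl])
  have A_minus: "A (- p) u = - A p u" for p u by (simp add: A_def poly_app_minus[OF xl])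
  note y0 = vec.linear_0[OF y(1)]
  have vW: "v \<in> W" using WI[of 1 0] by (simp add: A_1 A_0 y0)
  have "Fq_subspace W"
    unfolding Fq_subspace_def
  proof (intro conjI ballI)
    show "0 \<in> W" using WI[of 0 0] by (simp add: A_0 y0)
    fix a b assume "a \<in> W" "b \<in> W"
    then obtain f g f' g' where *: "a = A f v + y (A g v)" "qp f" "qp g"
      "b = A f' v + y (A g' v)" "qp f'" "qp g'" unfolding W_def by blast
    then have "a + b = A (f + f') v + y (A (g + g') v)"
      by (simp add: A_add vec.linear_add[OF y(1)])
    then show "a + b \<in> W" using WI[of "f + f'" "g + g'"] * by (simp add: qp_add)
  next
    fix c a assume "c \<in> Fq" "a \<in> W"
    then obtain f g where *: "a = A f v + y (A g v)" "qp f" "qp g"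
      unfolding W_def by blast
    then have "c *s a = A (smult c f) v + y (A (smult c g) v)"
      by (simp add: A_smult vec.scale_right_distrib vec.linear_scale[OF y(1)])
    then show "c *s a \<in> W" using WI[of "smult c f" "smult c g"] * \<open>c \<in> Fq\<close> by (simp add: qp_smult)
  qed
  moreover have WU: "W \<subseteq> U"
    unfolding W_def using v(1) by (auto intro!: vec.subspace_add[OF U(1)] A_U yU)
  moreover have "s a \<in> W" if "a \<in> W" for a
  proof -
    from that obtain f g where *: "a = A f v + y (A g v)" "qp f" "qp g"
      unfolding W_def by blast
    have "s a = A (smult \<epsilon> f) v + y (A (smult (- \<epsilon>) g) v)"
      by (simp add: * A_smult A_minus vec.linear_add[OF s(1)] s_A[OF v(2)] sy vec.linear_scale[OF y(1)]
        vec.linear_neg[OF y(1)])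
    then show ?thesis using WI[of "smult \<epsilon> f" "smult (- \<epsilon>) g"] * \<epsilon> by (auto simp: qp_minus)
  qed
  moreover have "y a \<in> W" if "a \<in> W" for a
  proof -
    from that obtain f g where *: "a = A f v + y (A g v)" "qp f" "qp g"
      unfolding W_def by blast
    have "y (y (A g v)) = A (monom 1 1 * g) v" by (simp add: A_mult A_X x_def)
    then have "y a = A (monom 1 1 * g) v + y (A f v)"
      by (simp add: * vec.linear_add[OF y(1)] add.commute)
    then show ?thesis using WI[of "monom 1 1 * g" f] * by (simp add: qp_mult)
  qed
  moreover have s_y: "s (y (A g v)) = - \<epsilon> *s y (A g v)" for g
    by (simp add: sy s_A[OF v(2)] vec.linear_scale[OF y(1)])
  then have orth: "H (A f v) (y (A g v)) = 0" "H (y (A g v)) (A f v) = 0" for f g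
    using eigen_orthogonal[OF s_A[OF v(2)] s_y \<epsilon>] H_eq_0_sym by blast+
  have H_AA: "H (A f v) (A g v) = H v (A (f * g) v)" if "qp f" for f g
    using that by (simp add: A_adj A_mult)
  have H_yy: "H (y (A f v)) (y (A g v)) = - H v (A (f * (monom 1 1 * g)) v)" if "qp f" for f g
    using that by (simp add: y(2) A_adj A_mult A_X x_def)
  have H_A: "H v (A f v) \<in> Fq" if "qp f" for f
    using that by (intro H_in_Fq) (simp add: A_adj)
  have "\<forall>a\<in>W. \<forall>b\<in>W. H a b \<in> Fq"
    unfolding W_def
    by (auto simp: H_add H_add_left orth H_AA H_yy intro!: Fq_add Fq_diff H_A qp_mult qp_monom)
  moreover have "nondegenerate W"
    unfolding nondegenerate_def
  proof (intro ballI impI)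
    fix a assume a: "a \<in> W" "\<forall>b\<in>W. H b a = 0"
    then obtain f g where *: "a = A f v + y (A g v)" "qp f" "qp g"
      unfolding W_def by blast
    \<comment> \<open>Testing against even elements isolates \<open>f\<close>. Testing against odd
      elements, in \<open>2\<close>, isolates \<open>g\<close> with an extra factor
      \<open>X\<close>, because moving \<open>y\<close> across the form turns the two copies of
      \<open>y\<close> into \<open>x\<close>.\<close>
    have 1: "H v (A (h * f) v) = 0" if "qp h" for h
      using a(2)[rule_format, OF WI[OF that, of 0]] that
      by (simp add: * A_0 y0 H_add H_AA orth)
    have 2: "H v (A (h * (monom 1 1 * g)) v) = 0" if "qp h" for h
      using a(2)[rule_format, OF WI[OF _ that, of 0]] that
      by (simp add: * A_0 H_add H_yy orth)
    \<comment> \<open>If \<open>f\<close> acted nontrivially on \<open>U\<close>, some multiple of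
      it would act as \<open>P ^ K\<close>, and \<open>1\<close> would contradict the choice of
      \<open>v\<close>.\<close>
    have fv: "A f v = 0"
      using socle0[OF *(2)] 1 v(1,3) by (metis mult.commute)
    have "A g u = 0" if u: "u \<in> U" for u
    proof (cases "\<forall>u\<in>U. A g u = 0")
      case False
      then obtain h where h: "qp h" "\<forall>u\<in>U. A (g * h) u = A (P ^ K) u" using socle0[OF *(3)] by blast
      \<comment> \<open>Since \<open>x ^^ N\<close> is the identity on \<open>U\<close>, the factor
        \<open>X^(N-1)\<close> cancels the extra \<open>X\<close> in \<open>2\<close>. This is where
        bijectivity of \<open>y \<circ> y\<close> enters.\<close>
      have "A (h * monom 1 (N - 1) * (monom 1 1 * g)) v = A (g * h) (A (monom 1 (N - 1) * monom 1 1) v)"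
        unfolding A_mult[symmetric] by (simp add: mult_ac)
      also have "A (monom 1 (N - 1) * monom 1 1) v = v"
        using N v(1) by (simp add: mult_monom A_X x_def)
      finally show ?thesis using 2[of "h * monom 1 (N - 1)"] h v(1,3) by (simp add: qp_mult)
    qed (use u in blast)
    then show "a = 0" by (simp add: * fv v(1) y0)
  qed
  moreover have "W \<noteq> {0}" using vW v(3) by auto
  ultimately show ?thesis
    unfolding quadratic_Fq_subspace_def by blast
qed

lemma exists_quadratic_Fq_subspace:
  "\<exists>W. quadratic_Fq_subspace W \<and> W \<noteq> {0} \<and> W \<subseteq> U \<and> s ` W \<subseteq> W \<and> y ` W \<subseteq> W"
proof -
  have "lin (y \<circ> y)" by (rule Vector_Spaces.linear_compose[OF y(1) y(1)])
  then have "poly_app (y \<circ> y) (monom 1 1) = y \<circ> y"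
    using poly_app_X_power[of "y \<circ> y" 1] by (simp add: fun_eq_iff)
  then show ?thesis
    using nilpotent_or_bijective[OF qp_monom[of 1]] nilpotent_case bijective_case by metis
qed

end

section \<open>Decomposition under an inverting involution\<close>

context hermitian_space
begin

lemma orthogonal_projection:
  assumes X: "vec.subspace X" "nondegenerate X"
  obtains x where "x \<in> X" "\<And>b. b \<in> X \<Longrightarrow> H b (v - x) = 0"
proof -
  obtain B where B: "finite B" "B \<subseteq> X" "vec.independent B" "vec.span B = X"
    by (rule vec.basis_subspace_exists[OF X(1)])
  txt \<open>\<open>L\<close> has kernel \<open>X\<^sup>\<bottom>\<close> and is injective on \<open>X\<close>, hence maps the finite set \<open>X\<close> onto itself.\<close>
  define L where "L u = (\<Sum>b\<in>B. H b u *s b)" for u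
  have L_diff: "L (u - w) = L u - L w" for u w
    by (simp add: L_def H_diff vec.scale_left_diff_distrib sum_subtractf)
  have LX: "L u \<in> X" for u
    unfolding L_def using B(2) by (intro vec.subspace_sum[OF X(1)] vec.subspace_scale[OF X(1)]) auto
  have L_0: "H b u = 0" if "L u = 0" "b \<in> X" for b u
  proof -
    have "H u b = 0" if "b \<in> B" for b
      using vec.independentD[OF B(3,1) order.refl, of "\<lambda>b. H b u" b] \<open>L u = 0\<close> that H_eq_0_sym
      by (simp add: L_def)
    moreover have "vec.subspace {b. H u b = 0}"
      by (auto simp: vec.subspace_def H_add H_scale)
    ultimately have "vec.span B \<subseteq> {b. H u b = 0}"
      by (intro vec.span_minimal) auto
    then show ?thesis using that B(4) H_eq_0_sym by blast
  qed
  have "inj_on L X"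
  proof (rule inj_onI)
    fix u w assume uw: "u \<in> X" "w \<in> X" "L u = L w"
    then have "L (u - w) = 0" "u - w \<in> X" by (auto simp: L_diff intro: vec.subspace_diff[OF X(1)])
    then have "u - w = 0" using nondegenerateD[OF X(2)] L_0 by blast
    then show "u = w" by simp
  qed
  then have "L ` X = X" using LX by (intro endo_inj_surj) auto
  then obtain x where "x \<in> X" "L x = L v" using LX[of v] by (metis imageE)
  then show thesis using L_0[of "v - x"] by (intro that[of x]) (auto simp: L_diff)
qed

lemma Fq_subspaceD:
  assumes "Fq_subspace W"
  shows "0 \<in> W" "u \<in> W \<Longrightarrow> v \<in> W \<Longrightarrow> u + v \<in> W" "c \<in> Fq \<Longrightarrow> u \<in> W \<Longrightarrow> c *s u \<in> W"
    "u \<in> W \<Longrightarrow> v \<in> W \<Longrightarrow> u - v \<in> W"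
proof -
  show *: "0 \<in> W" "\<And>u v. u \<in> W \<Longrightarrow> v \<in> W \<Longrightarrow> u + v \<in> W" "\<And>c u. c \<in> Fq \<Longrightarrow> u \<in> W \<Longrightarrow> c *s u \<in> W"
    using assms by (auto simp: Fq_subspace_def)
  show "u - v \<in> W" if "u \<in> W" "v \<in> W"
    using *(2)[OF that(1) *(3)[OF Fq_minus[OF Fq_1] that(2)]] by simp
qed

text \<open>The sums \<open>a + \<omega> *s b\<close> are closed under every scalar
  \<open>c\<close>, because both \<open>c\<close> and \<open>c * \<omega>\<close> decompose over 1
  and \<open>\<omega>\<close> with coefficients in \<open>Fq\<close>.\<close>

lemma span_Fq_subspace:
  assumes W: "Fq_subspace W" and x: "x \<in> vec.span W"
  obtains a b where "a \<in> W" "b \<in> W" "x = a + \<omega> *s b"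
proof -
  define S where "S = {a + \<omega> *s b |a b. a \<in> W \<and> b \<in> W}"
  have SI: "a + \<omega> *s b \<in> S" if "a \<in> W" "b \<in> W" for a b using that by (auto simp: S_def)
  have "vec.subspace S"
    unfolding vec.subspace_def
  proof (intro conjI allI ballI)
    show "0 \<in> S" using SI[of 0 0] Fq_subspaceD(1)[OF W] by simp
    fix u v assume "u \<in> S" "v \<in> S"
    then obtain a b a' b' where *: "u = a + \<omega> *s b" "v = a' + \<omega> *s b'"
      "a \<in> W" "b \<in> W" "a' \<in> W" "b' \<in> W" by (auto simp: S_def)
    have "u + v = (a + a') + \<omega> *s (b + b')" using * by (simp add: vec.scale_right_distrib)
    then show "u + v \<in> S" using SI Fq_subspaceD(2)[OF W] * by metis
  next
    fix c u assume "u \<in> S"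
    then obtain a b where *: "u = a + \<omega> *s b" "a \<in> W" "b \<in> W" by (auto simp: S_def)
    obtain \<alpha> \<beta> where 1: "\<alpha> \<in> Fq" "\<beta> \<in> Fq" "c = \<alpha> + \<omega> * \<beta>" by (rule Fq_decompose)
    obtain \<gamma> \<delta> where 2: "\<gamma> \<in> Fq" "\<delta> \<in> Fq" "c * \<omega> = \<gamma> + \<omega> * \<delta>" by (rule Fq_decompose)
    have "c *s u = c *s a + (c * \<omega>) *s b" by (simp add: * vec.scale_right_distrib)
    also have "\<dots> = (\<alpha> *s a + \<gamma> *s b) + \<omega> *s (\<beta> *s a + \<delta> *s b)"
      unfolding 2(3) unfolding 1(3) by (simp add: vec.scale_right_distrib vec.scale_left_distrib)
    finally show "c *s u \<in> S" using SI Fq_subspaceD(2,3)[OF W] * 1 2 by metis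
  qed
  moreover have "W \<subseteq> S" using SI[of _ 0] Fq_subspaceD(1)[OF W] by auto
  ultimately have "x \<in> S" using vec.span_minimal x by blast
  then show thesis using that by (auto simp: S_def)
qed

text \<open>The values \<open>H w a\<close> and \<open>H w b\<close> lie in \<open>Fq\<close>, so
  independence of 1 and \<open>\<omega>\<close> makes both vanish: nondegeneracy survives extension
  of scalars.\<close>

lemma quadratic_Fq_subspace_omega:
  assumes W: "quadratic_Fq_subspace W" and ab: "a \<in> W" "b \<in> W"
    and orth: "\<And>w. w \<in> W \<Longrightarrow> H w (a + \<omega> *s b) = 0"
  shows "a = 0" "b = 0"
proof -
  have "H w a = 0 \<and> H w b = 0" if "w \<in> W" for w
    using orth[OF that] Fq_omega_eq_0[of "H w a" "H w b"] W that ab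
    by (auto simp: quadratic_Fq_subspace_def H_add H_scale)
  then show "a = 0" "b = 0" using W ab nondegenerateD by (auto simp: quadratic_Fq_subspace_def)
qed

lemma quadratic_Fq_subspace_orthogonal_sum:
  assumes W: "quadratic_Fq_subspace W" and W': "quadratic_Fq_subspace W'"
    and orth: "\<And>u v. u \<in> W \<Longrightarrow> v \<in> W' \<Longrightarrow> H u v = 0"
  shows "quadratic_Fq_subspace {u + v |u v. u \<in> W \<and> v \<in> W'}" (is "quadratic_Fq_subspace ?S")
proof -
  have Fs: "Fq_subspace W" "Fq_subspace W'" using W W' by (auto simp: quadratic_Fq_subspace_def)
  note D = Fq_subspaceD[OF Fs(1)] and D' = Fq_subspaceD[OF Fs(2)]
  have orth': "H v u = 0" if "u \<in> W" "v \<in> W'" for u v using orth[OF that] H_eq_0_sym by blast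
  have "Fq_subspace ?S"
    unfolding Fq_subspace_def
  proof (intro conjI ballI)
    show "0 \<in> ?S" using D(1) D'(1) by (intro CollectI exI[of _ 0]) auto
    fix x y assume "x \<in> ?S" "y \<in> ?S"
    then obtain u v u' v' where "x = u + v" "y = u' + v'" "u \<in> W" "v \<in> W'" "u' \<in> W" "v' \<in> W'"
      by blast
    then show "x + y \<in> ?S"
      using D(2) D'(2) by (intro CollectI exI[of _ "u + u'"] exI[of _ "v + v'"]) auto
  next
    fix c x assume "c \<in> Fq" "x \<in> ?S"
    then obtain u v where "x = u + v" "u \<in> W" "v \<in> W'" by blast
    then show "c *s x \<in> ?S" using D(3) D'(3) \<open>c \<in> Fq\<close>
      by (intro CollectI exI[of _ "c *s u"] exI[of _ "c *s v"]) (auto simp: vec.scale_right_distrib)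
  qed
  moreover have "\<forall>x\<in>?S. \<forall>y\<in>?S. H x y \<in> Fq"
    using W W' by (auto simp: H_add H_add_left orth orth' quadratic_Fq_subspace_def intro!: Fq_add)
  moreover have "nondegenerate ?S"
    unfolding nondegenerate_def
  proof (intro ballI impI)
    fix x assume "x \<in> ?S" and x: "\<forall>v\<in>?S. H v x = 0"
    then obtain u v where uv: "x = u + v" "u \<in> W" "v \<in> W'" by blast
    have "H w u = 0" if "w \<in> W" for w
    proof -
      have "w \<in> ?S" using that D'(1) by (intro CollectI exI[of _ w] exI[of _ 0]) auto
      then have "H w x = 0" using x by blast
      then show ?thesis using that uv(3) by (simp add: uv(1) H_add orth)
    qed
    moreover have "H w v = 0" if "w \<in> W'" for w
    proof -
      have "w \<in> ?S" using that D(1) by (intro CollectI exI[of _ 0] exI[of _ w]) auto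
      then have "H w x = 0" using x by blast
      then show ?thesis using that uv(2) by (simp add: uv(1) H_add orth')
    qed
    ultimately have "u = 0" "v = 0"
      using W W' uv(2,3) nondegenerateD by (auto simp: quadratic_Fq_subspace_def)
    then show "x = 0" by (simp add: uv)
  qed
  ultimately show ?thesis by (simp add: quadratic_Fq_subspace_def)
qed

end

section \<open>Minimal stable subspaces and the Cayley transform\<close>

text \<open>For an involution, being self-adjoint is the same as being an isometry; likewise
  \<open>g_adj\<close> expresses that \<open>g\<close>, with inverse \<open>gi\<close>, is an
  isometry.\<close>

locale inverting_involution = hermitian_space q H
  for q :: nat and H :: "'a::{field,finite}^'n \<Rightarrow> 'a^'n \<Rightarrow> 'a" +
  fixes s g gi :: "'a^'n \<Rightarrow> 'a^'n"
  assumes s: "lin s" "\<And>v. s (s v) = v" "\<And>u v. H (s u) v = H u (s v)"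
    and g: "lin g" "lin gi" "\<And>v. g (gi v) = v" "\<And>v. gi (g v) = v"
    and g_adj: "\<And>u v. H (g u) v = H u (gi v)"
    and sg: "\<And>v. s (g v) = gi (s v)"
begin

lemma gi_adj: "H (gi u) v = H u (g v)"
  using g_adj[of "gi u" "g v"] g by simp

lemma sgi: "s (gi v) = g (s v)"
  by (metis s(2) sg)

definition admissible :: "('a^'n) set \<Rightarrow> bool" where
  "admissible U \<longleftrightarrow> vec.subspace U \<and> nondegenerate U \<and> (\<forall>u\<in>U. s u \<in> U \<and> g u \<in> U \<and> gi u \<in> U)"

definition minimal_admissible :: "('a^'n) set \<Rightarrow> bool" where
  "minimal_admissible U \<longleftrightarrow> admissible U \<and> U \<noteq> {0} \<and>
     (\<forall>U'. admissible U' \<longrightarrow> U' \<subseteq> U \<longrightarrow> U' = {0} \<or> U' = U)"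

text \<open>An idempotent power \<open>e\<close> of \<open>f\<close> is a self-adjoint projection
  commuting with the action, so its image on \<open>U\<close> is again stable and nondegenerate.
  Minimality leaves only the zero image and all of \<open>U\<close>.\<close>

lemma fitting:
  assumes U: "minimal_admissible U"
    and f: "lin f" "\<And>u v. H (f u) v = H u (f v)" "\<And>u. u \<in> U \<Longrightarrow> f u \<in> U"
    and comm: "\<And>v. f (s v) = s (f v)" "\<And>v. f (g v) = g (f v)" "\<And>v. f (gi v) = gi (f v)"
  shows "\<exists>N\<ge>1. (\<forall>u\<in>U. (f ^^ N) u = 0) \<or> (\<forall>u\<in>U. (f ^^ N) u = u)"
proof -
  obtain N where N: "N \<ge> 1" "\<And>v. (f ^^ N) ((f ^^ N) v) = (f ^^ N) v"
    by (rule funpow_idempotent_exists[of f]) blast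
  define e where "e = f ^^ N"
  have e: "lin e" "\<And>u v. H (e u) v = H u (e v)" "\<And>v. e (e v) = e v"
    unfolding e_def using N lin_funpow[OF f(1)] funpow_adjoint[of f, OF f(2)] by auto
  have eU: "e u \<in> U" if "u \<in> U" for u
    unfolding e_def using that by (intro funpow_mem f(3))
  have ec: "e (s v) = s (e v)" "e (g v) = g (e v)" "e (gi v) = gi (e v)" for v
    unfolding e_def by (intro funpow_commute_op comm)+
  have adm: "admissible U" using U by (simp add: minimal_admissible_def)
  have "admissible (e ` U)"
    unfolding admissible_def
  proof (intro conjI ballI)
    show "vec.subspace (e ` U)"
      using vec.linear_subspace_image[OF e(1)] adm by (simp add: admissible_def)
    show "nondegenerate (e ` U)"
      unfolding nondegenerate_def
    proof (intro ballI impI)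
      fix u assume u: "u \<in> e ` U" "\<forall>v\<in>e ` U. H v u = 0"
      then have eu: "e u = u" "u \<in> U" using e(3) eU by auto
      have "H v u = 0" if "v \<in> U" for v
        using u(2) that e(2)[of v u] eu by auto
      then show "u = 0" using adm eu(2) nondegenerateD by (auto simp: admissible_def)
    qed
    fix u assume "u \<in> e ` U"
    then obtain v where "u = e v" "v \<in> U" by blast
    then show "s u \<in> e ` U" "g u \<in> e ` U" "gi u \<in> e ` U"
      using adm by (auto simp: admissible_def simp flip: ec)
  qed
  moreover have "e ` U \<subseteq> U" using eU by blast
  ultimately have "e ` U = {0} \<or> e ` U = U" using U unfolding minimal_admissible_def by blast
  then have "(\<forall>u\<in>U. e u = 0) \<or> (\<forall>u\<in>U. e u = u)"
  proof
    assume "e ` U = {0}"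
    then have "e u = 0" if "u \<in> U" for u using imageI[OF that, of e] by simp
    then show ?thesis by simp
  next
    assume eq: "e ` U = U"
    have "e u = u" if "u \<in> U" for u
    proof -
      have "u \<in> e ` U" unfolding eq by (rule that)
      then obtain v where "u = e v" by (rule imageE)
      then show ?thesis using e(3) by simp
    qed
    then show ?thesis by simp
  qed
  then show ?thesis using N(1) unfolding e_def by metis
qed

text \<open>This is \<open>(g + 1) (g^-1 + 1)\<close>, a self-adjoint substitute for
  \<open>g + 1\<close> to which \<open>fitting\<close> applies.\<close>

definition trace_op :: "'a^'n \<Rightarrow> 'a^'n" where
  "trace_op v = 2 *s v + (g v + gi v)"

lemma lin_trace_op: "lin trace_op"
  unfolding trace_op_def[abs_def]
  by (intro vec.linear_compose_add vec.linear_scale_self g)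

lemma trace_op_adj: "H (trace_op u) v = H u (trace_op v)"
proof -
  have "(2::'a) \<in> Fq" using Fq_add[OF Fq_1 Fq_1] by simp
  then show ?thesis
    by (simp add: trace_op_def H_add H_add_left H_scale H_scale_left_Fq g_adj gi_adj)
qed

lemma trace_op_commute:
  "trace_op (s v) = s (trace_op v)" "trace_op (g v) = g (trace_op v)" "trace_op (gi v) = gi (trace_op v)"
  using g by (simp_all add: trace_op_def vec.linear_add[OF s(1)] vec.linear_scale[OF s(1)] sg sgi
    vec.linear_add[OF g(1)] vec.linear_scale[OF g(1)] vec.linear_add[OF g(2)] vec.linear_scale[OF g(2)])

lemma trace_op_mem:
  assumes "admissible U" "u \<in> U"
  shows "trace_op u \<in> U"
  using assms unfolding trace_op_def admissible_def
  by (auto intro!: vec.subspace_add vec.subspace_scale)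

lemma trace_op_cases:
  assumes "minimal_admissible U"
  shows "\<exists>N\<ge>1. (\<forall>u\<in>U. (trace_op ^^ N) u = 0) \<or> (\<forall>u\<in>U. (trace_op ^^ N) u = u)"
  using assms
  by (intro fitting lin_trace_op trace_op_adj trace_op_commute trace_op_mem)
    (auto simp: minimal_admissible_def)

text \<open>\<open>g\<close> is recovered from its Cayley transform \<open>y\<close> as
  \<open>(1 + y) / (1 - y)\<close>, so a finite \<open>y\<close>-stable subspace on which
  \<open>1 - y\<close> is injective is also \<open>g\<close>-stable.\<close>

lemma cayley:
  assumes U: "minimal_admissible U" and N: "N \<ge> 1" "\<And>u. u \<in> U \<Longrightarrow> (trace_op ^^ N) u = u"
  shows "\<exists>W. quadratic_Fq_subspace W \<and> W \<noteq> {0} \<and> W \<subseteq> U \<and> s ` W \<subseteq> W \<and> g ` W \<subseteq> W"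
proof -
  have adm: "admissible U" and U0: "U \<noteq> {0}" using U by (auto simp: minimal_admissible_def)
  then have sub: "vec.subspace U" "nondegenerate U"
    and Us: "u \<in> U \<Longrightarrow> s u \<in> U" "u \<in> U \<Longrightarrow> g u \<in> U" "u \<in> U \<Longrightarrow> gi u \<in> U" for u
    by (auto simp: admissible_def)
  \<comment> \<open>\<open>T\<close> inverts \<open>trace_op\<close> on \<open>U\<close>. As a power
    of \<open>trace_op\<close> it is self-adjoint and commutes with \<open>s\<close>,
    \<open>g\<close> and \<open>gi\<close> on the whole space.\<close>
  define T where "T = trace_op ^^ (N - 1)"
  have T: "lin T" unfolding T_def by (rule lin_funpow[OF lin_trace_op])
  have T_adj: "H (T u) v = H u (T v)" for u v
    unfolding T_def by (rule funpow_adjoint) (rule trace_op_adj)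
  have T_comm: "T (s v) = s (T v)" "T (g v) = g (T v)" "T (gi v) = gi (T v)" for v
    unfolding T_def by (intro funpow_commute_op trace_op_commute)+
  have T_U: "T u \<in> U" if "u \<in> U" for u
    unfolding T_def using that by (intro funpow_mem trace_op_mem[OF adm])
  have T_trace: "T (trace_op u) = u" if "u \<in> U" for u
  proof -
    have "T (trace_op u) = (trace_op ^^ Suc (N - 1)) u" by (simp add: T_def funpow_swap1)
    then show ?thesis using N that by simp
  qed
  txt \<open>On \<open>U\<close> this is \<open>(g - 1) / (g + 1)\<close>, since \<open>(g - g\<^sup>-\<^sup>1) (g + 1) = (g - 1) (2 + g + g\<^sup>-\<^sup>1)\<close>.\<close>
  define y where "y v = g (T v) - gi (T v)" for v
  have y: "lin y"
    unfolding y_def[abs_def]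
    using Vector_Spaces.linear_compose[OF T g(1)] Vector_Spaces.linear_compose[OF T g(2)]
    by (intro vec.linear_compose_sub) (auto simp: o_def)
  have y_skew: "H (y u) v = - H u (y v)" for u v
    by (simp add: y_def H_diff g_adj gi_adj T_adj T_comm)
  have sy: "s (y v) = - y (s v)" for v
    by (simp add: y_def vec.linear_diff[OF s(1)] sg sgi T_comm)
  have yg: "y (g v) = g (y v)" "y (gi v) = gi (y v)" for v
    using g by (simp_all add: y_def T_comm vec.linear_diff[OF g(1)] vec.linear_diff[OF g(2)])
  have yU: "y u \<in> U" if "u \<in> U" for u
    unfolding y_def using that by (intro vec.subspace_diff[OF sub(1)] Us T_U)
  interpret skew: skew_pair q H s y U
  proof (intro skew_pair.intro skew_pair_axioms.intro hermitian_space_axioms)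
    fix p :: "'a poly" assume p: "qp p"
    have yy: "lin (y \<circ> y)" by (rule Vector_Spaces.linear_compose[OF y y])
    show "\<exists>N\<ge>1. (\<forall>u\<in>U. (poly_app (y \<circ> y) p ^^ N) u = 0) \<or> (\<forall>u\<in>U. (poly_app (y \<circ> y) p ^^ N) u = u)"
    proof (rule fitting[OF U lin_poly_app[OF yy]])
      show "H (poly_app (y \<circ> y) p u) v = H u (poly_app (y \<circ> y) p v)" for u v
        by (rule poly_app_adjoint[OF yy _ p]) (simp add: y_skew)
      show "poly_app (y \<circ> y) p u \<in> U" if "u \<in> U" for u
        by (rule poly_app_mem_subspace[OF yy sub(1) _ that]) (simp add: yU)
      show "poly_app (y \<circ> y) p (s v) = s (poly_app (y \<circ> y) p v)"
        and "poly_app (y \<circ> y) p (g v) = g (poly_app (y \<circ> y) p v)"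
        and "poly_app (y \<circ> y) p (gi v) = gi (poly_app (y \<circ> y) p v)" for v
        by (rule poly_app_commute[OF yy]; simp add: s g yg sy vec.linear_neg[OF y])+
    qed
  qed (use s y y_skew sy sub U0 Us yU in auto)
  obtain W where W: "quadratic_Fq_subspace W" "W \<noteq> {0}" "W \<subseteq> U" "s ` W \<subseteq> W" "y ` W \<subseteq> W"
    using skew.exists_quadratic_Fq_subspace by blast
  have cayley: "y (g u + u) = g u - u" if "u \<in> U" for u
  proof -
    have "y (g u + u) = T (g (g u) + g u - u - gi u)"
      using g by (simp add: y_def vec.linear_add[OF g(1)] vec.linear_add[OF g(2)] vec.linear_add[OF T]
        vec.linear_diff[OF T] T_comm algebra_simps)
    also have "g (g u) + g u - u - gi u = trace_op (g u - u)"
      using g by (simp add: trace_op_def vec.linear_diff[OF g(1)] vec.linear_diff[OF g(2)]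
        vec.scale_right_diff_distrib vec.scale_left_distrib[of 1 1, simplified] algebra_simps)
    also have "T \<dots> = g u - u"
      using that by (intro T_trace vec.subspace_diff[OF sub(1)] Us)
    finally show ?thesis .
  qed
  have gy: "g (y u) = g u - u - y u" if "u \<in> U" for u
    using cayley[OF that] by (simp add: vec.linear_add[OF y] yg algebra_simps)
  \<comment> \<open>A difference \<open>c\<close> in the kernel satisfies \<open>y c = c\<close>,
    and then \<open>gy\<close> reduces to \<open>2 *s c = 0\<close>.\<close>
  have inj: "inj_on (\<lambda>u. u - y u) W"
  proof (rule inj_onI)
    fix a b assume ab: "a \<in> W" "b \<in> W" "a - y a = b - y b"
    let ?c = "a - b"
    have c: "?c \<in> U" "y ?c = ?c"
      using ab W(3) by (auto simp: vec.linear_diff[OF y] algebra_simps intro: vec.subspace_diff[OF sub(1)])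
    then have "2 *s ?c = 0"
      using gy[OF c(1)] by (simp add: vec.scale_left_distrib[of 1 1, simplified])
    then show "a = b" by simp
  qed
  have Fs: "Fq_subspace W" using W(1) by (simp add: quadratic_Fq_subspace_def)
  have "(\<lambda>u. u - y u) ` W \<subseteq> W" using Fq_subspaceD(4)[OF Fs] W(5) by blast
  then have surj: "(\<lambda>u. u - y u) ` W = W" using inj by (rule endo_inj_surj[OF finite])
  have "g w \<in> W" if "w \<in> W" for w
  proof -
    have "w \<in> (\<lambda>u. u - y u) ` W" unfolding surj by (rule that)
    then obtain u where u: "u \<in> W" "w = u - y u" by blast
    have "u \<in> U" using u(1) W(3) by blast
    then have "g w = u + y u" unfolding u(2) vec.linear_diff[OF g(1)] gy[OF \<open>u \<in> U\<close>] by simp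
    moreover have "y u \<in> W" using u(1) W(5) by blast
    ultimately show ?thesis using u(1) Fq_subspaceD(2)[OF Fs] by simp
  qed
  then show ?thesis using W by blast
qed

lemma inverting_involution_neg: "inverting_involution q H s (\<lambda>v. - g v) (\<lambda>v. - gi v)"
  by (intro inverting_involution.intro inverting_involution_axioms.intro hermitian_space_axioms)
    (use s g in \<open>auto simp: g_adj H_minus sg vec.linear_neg[OF s(1)] vec.linear_neg[OF g(1)]
      vec.linear_neg[OF g(2)] intro: vec.linear_compose_neg\<close>)

text \<open>When \<open>trace_op\<close> is nilpotent on \<open>U\<close>, the Cayley transform is
  applied to \<open>- g\<close> instead; stability under \<open>- g\<close> and under
  \<open>g\<close> is the same for an \<open>Fq\<close>-subspace.\<close>

lemma exists_in_minimal:
  assumes U: "minimal_admissible U"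
  shows "\<exists>W. quadratic_Fq_subspace W \<and> W \<noteq> {0} \<and> W \<subseteq> U \<and> s ` W \<subseteq> W \<and> g ` W \<subseteq> W"
proof -
  have adm: "admissible U" and U0: "U \<noteq> {0}" using U by (auto simp: minimal_admissible_def)
  obtain N where N: "N \<ge> 1" "(\<forall>u\<in>U. (trace_op ^^ N) u = 0) \<or> (\<forall>u\<in>U. (trace_op ^^ N) u = u)"
    using trace_op_cases[OF U] by blast
  show ?thesis
  proof (cases "\<forall>u\<in>U. (trace_op ^^ N) u = u")
    case True
    then show ?thesis using cayley[OF U N(1)] by blast
  next
    case False
    then have nil: "\<forall>u\<in>U. (trace_op ^^ N) u = 0" using N(2) by blast
    interpret neg: inverting_involution q H s "\<lambda>v. - g v" "\<lambda>v. - gi v"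
      by (rule inverting_involution_neg)
    have adm_eq: "neg.admissible X = admissible X" for X
    proof -
      have "- v \<in> X \<longleftrightarrow> v \<in> X" if "vec.subspace X" for v
        using vec.subspace_neg[OF that] by (metis minus_minus)
      then show ?thesis by (auto simp: neg.admissible_def admissible_def)
    qed
    have negU: "neg.minimal_admissible U"
      using U by (simp add: neg.minimal_admissible_def minimal_admissible_def adm_eq)
    obtain M where M: "M \<ge> 1"
      "(\<forall>u\<in>U. (neg.trace_op ^^ M) u = 0) \<or> (\<forall>u\<in>U. (neg.trace_op ^^ M) u = u)"
      using neg.trace_op_cases[OF negU] by blast
    \<comment> \<open>The operators for \<open>g\<close> and \<open>- g\<close> add up to
      multiplication by 4. A nonzero vector killed by the first is thus an eigenvector of the second
      with eigenvalue 4, which is nonzero in odd characteristic.\<close>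
    have "\<not> (\<forall>u\<in>U. (neg.trace_op ^^ M) u = 0)"
    proof
      assume nil': "\<forall>u\<in>U. (neg.trace_op ^^ M) u = 0"
      obtain u where u: "u \<in> U" "u \<noteq> 0"
        using U0 adm vec.subspace_0 by (auto simp: admissible_def)
      define Z where "Z n \<longleftrightarrow> (trace_op ^^ n) u = 0" for n
      have "Z N" "\<not> Z 0" using nil u by (auto simp: Z_def)
      then obtain k where k: "\<not> Z k" "Z (Suc k)" using ex_least_nat_less[of Z N] by blast
      define v where "v = (trace_op ^^ k) u"
      have v: "v \<noteq> 0" "trace_op v = 0" using k by (auto simp: v_def Z_def)
      have "v \<in> U" unfolding v_def using u(1) by (induction k) (auto intro: trace_op_mem[OF adm])
      have four: "neg.trace_op v = 4 *s v"
        using v(2) by (simp add: neg.trace_op_def trace_op_def algebra_simps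
          vec.scale_left_distrib[of 2 2, simplified] add_eq_0_iff2)
      have "(neg.trace_op ^^ n) v = (4 ^ n) *s v" for n
        by (induction n) (auto simp: vec.linear_scale[OF neg.lin_trace_op] four mult.commute)
      then have "(4::'a) ^ M = 0" using nil' \<open>v \<in> U\<close> v(1) by auto
      moreover have "(4::'a) = 2 * 2" by simp
      ultimately show False using two_neq_0 by (metis mult_eq_0_iff power_not_zero)
    qed
    then obtain W where W: "quadratic_Fq_subspace W" "W \<noteq> {0}" "W \<subseteq> U" "s ` W \<subseteq> W"
      "(\<lambda>v. - g v) ` W \<subseteq> W"
      using neg.cayley[OF negU M(1)] M(2) by blast
    have "g w \<in> W" if "w \<in> W" for w
    proof -
      have "0 - (- g w) \<in> W" using W(1,5) that Fq_subspaceD(1,4) 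
        unfolding quadratic_Fq_subspace_def by blast
      then show ?thesis by simp
    qed
    then show ?thesis using W by blast
  qed
qed

lemma exists_minimal_admissible:
  assumes "admissible X" "X \<noteq> {0}"
  obtains U where "minimal_admissible U" "U \<subseteq> X"
proof -
  define S where "S = {U. admissible U \<and> U \<noteq> {0} \<and> U \<subseteq> X}"
  have "finite S" "S \<noteq> {}" using assms by (auto simp: S_def)
  then obtain U where U: "U \<in> S" "\<And>U'. U' \<in> S \<Longrightarrow> U' \<subseteq> U \<Longrightarrow> U = U'"
    using finite_has_minimal[of S] by blast
  then have "minimal_admissible U" "U \<subseteq> X"
    unfolding minimal_admissible_def S_def by blast+
  then show thesis by (rule that)
qed

lemma exists_spanning_quadratic_Fq_subspace:
  obtains W where "quadratic_Fq_subspace W" "s ` W \<subseteq> W" "g ` W \<subseteq> W" "vec.span W = UNIV"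
proof -
  define S where "S = {W. quadratic_Fq_subspace W \<and> s ` W \<subseteq> W \<and> g ` W \<subseteq> W}"
  have "finite S" by simp
  moreover have "{0} \<in> S"
    by (auto simp: S_def quadratic_Fq_subspace_def Fq_subspace_def nondegenerate_def
      vec.linear_0[OF s(1)] vec.linear_0[OF g(1)])
  ultimately obtain W where WS: "W \<in> S" and max: "\<And>W'. W' \<in> S \<Longrightarrow> W \<subseteq> W' \<Longrightarrow> W = W'"
    using finite_has_maximal[of S] by blast
  then have W: "quadratic_Fq_subspace W" "s ` W \<subseteq> W" "g ` W \<subseteq> W" by (auto simp: S_def)
  then have Fs: "Fq_subspace W" by (simp add: quadratic_Fq_subspace_def)
  note D = Fq_subspaceD[OF Fs]
  \<comment> \<open>Finiteness turns stability of \<open>W\<close> under \<open>g\<close> into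
    stability under \<open>gi\<close>, which the admissibility of \<open>P\<close> requires.\<close>
  have "inj_on g W" using g(4) by (metis inj_onI)
  then have "g ` W = W" by (rule endo_inj_surj[OF finite W(3)])
  then have giW: "gi w \<in> W" if "w \<in> W" for w using that g(4) by (metis imageE)
  let ?X = "vec.span W"
  define P where "P = {u. \<forall>w\<in>W. H w u = 0}"
  have P_span: "H x u = 0" if "u \<in> P" "x \<in> ?X" for x u
    using span_Fq_subspace[OF Fs that(2)] that(1) by (force simp: P_def H_add_left H_scale_left)
  have X_P: "x = 0" if xX: "x \<in> ?X" and xP: "x \<in> P" for x
  proof -
    obtain a b where ab: "a \<in> W" "b \<in> W" "x = a + \<omega> *s b" using span_Fq_subspace[OF Fs xX] .
    then have "a = 0" "b = 0"
      using quadratic_Fq_subspace_omega[OF W(1) ab(1,2)] xP by (auto simp: P_def)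
    then show ?thesis using ab by simp
  qed
  have X: "vec.subspace ?X" "nondegenerate ?X"
  proof -
    show "nondegenerate ?X"
      unfolding nondegenerate_def
    proof (intro ballI impI)
      fix x assume x: "x \<in> ?X" "\<forall>v\<in>?X. H v x = 0"
      then have "x \<in> P" using vec.span_base unfolding P_def by blast
      then show "x = 0" using X_P x(1) by blast
    qed
  qed (rule vec.subspace_span)
  have split: "\<exists>x\<in>?X. v - x \<in> P" for v
  proof -
    obtain x where x: "x \<in> ?X" "\<And>b. b \<in> ?X \<Longrightarrow> H b (v - x) = 0"
      by (rule orthogonal_projection[OF X, of v]) blast
    then have "v - x \<in> P" using vec.span_base by (auto simp: P_def)
    then show ?thesis using x(1) by blast
  qed
  have "admissible P"
    unfolding admissible_def
  proof (intro conjI ballI)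
    show "vec.subspace P" by (auto simp: P_def vec.subspace_def H_add H_scale)
    show "nondegenerate P"
      unfolding nondegenerate_def
    proof (intro ballI impI)
      fix u assume u: "u \<in> P" "\<forall>v\<in>P. H v u = 0"
      have "H v u = 0" for v
      proof -
        obtain x where x: "x \<in> ?X" "v - x \<in> P" using split by blast
        have "H v u = H x u + H (v - x) u" by (simp flip: H_add_left)
        then show ?thesis using u x P_span by simp
      qed
      then show "u = 0" using H_nondegenerate H_eq_0_sym by blast
    qed
    fix u assume "u \<in> P"
    then show "s u \<in> P" "g u \<in> P" "gi u \<in> P"
      using W(2,3) giW by (auto simp: P_def simp flip: s(3) g_adj gi_adj)
  qed
  have "P = {0}"
  proof (rule ccontr)
    assume "P \<noteq> {0}"
    obtain U where U: "minimal_admissible U" "U \<subseteq> P"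
      using exists_minimal_admissible[OF \<open>admissible P\<close> \<open>P \<noteq> {0}\<close>] .
    obtain W' where W': "quadratic_Fq_subspace W'" "W' \<noteq> {0}" "W' \<subseteq> U" "s ` W' \<subseteq> W'" "g ` W' \<subseteq> W'"
      using exists_in_minimal[OF U(1)] by (elim exE conjE)
    have Fs': "Fq_subspace W'" using W'(1) by (simp add: quadratic_Fq_subspace_def)
    note D' = Fq_subspaceD[OF Fs']
    let ?S = "{u + v |u v. u \<in> W \<and> v \<in> W'}"
    have orth: "H u v = 0" if "u \<in> W" "v \<in> W'" for u v
      using that W'(3) U(2) unfolding P_def by blast
    have stable: "f ` ?S \<subseteq> ?S" if f: "lin f" "f ` W \<subseteq> W" "f ` W' \<subseteq> W'" for f
    proof (rule image_subsetI)
      fix x assume "x \<in> ?S"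
      then obtain u v where uv: "x = u + v" "u \<in> W" "v \<in> W'" by blast
      have "f u \<in> W" "f v \<in> W'" using uv f by blast+
      then show "f x \<in> ?S" unfolding uv(1) vec.linear_add[OF f(1)] by blast
    qed
    have "quadratic_Fq_subspace ?S"
      by (rule quadratic_Fq_subspace_orthogonal_sum[OF W(1) W'(1) orth])
    moreover have "s ` ?S \<subseteq> ?S" "g ` ?S \<subseteq> ?S"
      by (rule stable[OF s(1) W(2) W'(4)], rule stable[OF g(1) W(3) W'(5)])
    ultimately have "?S \<in> S" by (simp add: S_def)
    moreover have "W \<subseteq> ?S"
    proof
      fix w assume "w \<in> W"
      then show "w \<in> ?S" using D'(1) by (intro CollectI exI[of _ w] exI[of _ 0]) simp
    qed
    ultimately have eq: "W = ?S" by (rule max)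
    obtain w where w: "w \<in> W'" "w \<noteq> 0" using W'(2) D'(1) by blast
    have "w \<in> ?S" using w(1) D(1) by (intro CollectI exI[of _ 0] exI[of _ w]) simp
    then have "w \<in> W" by (subst eq)
    then have "w \<in> ?X" by (rule vec.span_base)
    moreover have "w \<in> P" using w(1) W'(3) U(2) by blast
    ultimately show False using X_P w(2) by blast
  qed
  then have "v \<in> ?X" for v using split[of v] by auto
  then show thesis using W that by blast
qed

end

section \<open>Embedded orthogonal groups and strong reality\<close>

text \<open>Splitting the coefficients of \<open>v\<close> over 1 and \<open>\<omega>\<close> writes
  0 as \<open>(?a - v) + \<omega> *s ?b\<close> with both vectors in \<open>W\<close>, so
  \<open>v\<close> is already the \<open>Fq\<close>-combination \<open>?a\<close>.\<close>

lemma (in hermitian_space) span_Fq_eq: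
  assumes W: "quadratic_Fq_subspace W" and B: "B \<subseteq> W" "vec.span B = UNIV"
  shows "span_Fq q B = W"
proof -
  have Fs: "Fq_subspace W" using W by (simp add: quadratic_Fq_subspace_def)
  note D = Fq_subspaceD[OF Fs]
  have sum: "(\<Sum>b\<in>B. c b *s b) \<in> W" if "\<forall>b\<in>B. c b \<in> Fq" for c
  proof -
    have "finite B" by simp
    then show ?thesis using B(1) that
      by (induction B rule: finite_induct) (auto intro!: D)
  qed
  have "v \<in> span_Fq q B" if v: "v \<in> W" for v
  proof -
    obtain c where c: "v = (\<Sum>b\<in>B. c b *s b)"
      using B(2) vec.span_finite[of B] by auto
    have "\<exists>\<alpha> \<beta>. \<alpha> \<in> Fq \<and> \<beta> \<in> Fq \<and> c b = \<alpha> + \<omega> * \<beta>" for b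
      by (metis Fq_decompose)
    then obtain \<alpha> \<beta> where ab: "\<And>b. \<alpha> b \<in> Fq" "\<And>b. \<beta> b \<in> Fq" "\<And>b. c b = \<alpha> b + \<omega> * \<beta> b"
      by metis
    let ?a = "\<Sum>b\<in>B. \<alpha> b *s b" and ?b = "\<Sum>b\<in>B. \<beta> b *s b"
    have "v = ?a + \<omega> *s ?b"
      unfolding c ab(3) by (simp add: vec.scale_left_distrib sum.distrib vec.scale_sum_right)
    then have "(?a - v) + \<omega> *s ?b = 0" by simp
    then have "?a - v = 0"
      using sum[of \<alpha>] sum[of \<beta>] ab(1,2) v by (intro quadratic_Fq_subspace_omega(1)[OF W, of _ ?b]) (auto intro: D)
    then have "v = ?a" by simp
    then show ?thesis using ab(1) unfolding span_Fq_def by blast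
  qed
  then show ?thesis using sum by (auto simp: span_Fq_def)
qed

text \<open>Inverses in a subgroup agree with those of the ambient group, so one condition on
  \<open>h\<close> serves for both groups and a witness can be carried over.\<close>

lemma strongly_real_subgroup_iff:
  assumes "group (matrix_monoid G)" "subgroup K (matrix_monoid G)" "K' = matrix_monoid K" "g \<in> K"
  shows "strongly_real K' g \<longleftrightarrow>
    (\<exists>h\<in>K. h ** g ** inv\<^bsub>matrix_monoid G\<^esub> h = inv\<^bsub>matrix_monoid G\<^esub> g \<and> h ** h = mat 1)"
proof -
  have K': "K' = (matrix_monoid G)\<lparr>carrier := K\<rparr>"
    by (simp add: assms(3) matrix_monoid_def)
  have "inv\<^bsub>K'\<^esub> x = inv\<^bsub>matrix_monoid G\<^esub> x" if "x \<in> K" for x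
    unfolding K' by (rule group.m_inv_consistent[OF assms(1,2) that])
  then show ?thesis
    using assms(4) by (auto simp: strongly_real_def assms(3)) (auto simp: matrix_monoid_def)
qed

theorem corollary7p3:
  fixes q :: nat and \<eta> g :: "'a::{field,finite}^'n^'n"
  assumes "primepow q" and "odd q" and "CARD('a) = q\<^sup>2"
    and "hermitian_matrix q \<eta>" and "invertible \<eta>"
    and "g \<in> SU q \<eta>"
  shows "strongly_real (matrix_monoid (SU q \<eta>)) g \<longleftrightarrow>
    (\<exists>V\<^sub>0. orthogonal_Fq_form q \<eta> V\<^sub>0 \<and>
      g \<in> embedded_SO q \<eta> V\<^sub>0 \<and>
      strongly_real (matrix_monoid (embedded_SO q \<eta> V\<^sub>0)) g)"
proof
  let ?G = "matrix_monoid (SU q \<eta>)"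
  note q = assms(1,3)
  interpret G: group ?G by (rule group_SU)
  have sub_SU: "subgroup (SU q \<eta>) ?G"
    using G.subgroup_self by (simp add: matrix_monoid_def)
  show "strongly_real ?G g" if ex: "\<exists>V\<^sub>0. orthogonal_Fq_form q \<eta> V\<^sub>0 \<and>
      g \<in> embedded_SO q \<eta> V\<^sub>0 \<and> strongly_real (matrix_monoid (embedded_SO q \<eta> V\<^sub>0)) g"
  proof -
    obtain V where V: "orthogonal_Fq_form q \<eta> V" "g \<in> embedded_SO q \<eta> V"
      "strongly_real (matrix_monoid (embedded_SO q \<eta> V)) g" using ex by blast
    have sub: "subgroup (embedded_SO q \<eta> V) ?G" by (rule subgroup_embedded_SO[OF q V(1)])
    show ?thesis
      using V(3) embedded_SO_subset_SU[OF q V(1)]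
      unfolding strongly_real_subgroup_iff[OF group_SU sub refl V(2)]
        strongly_real_subgroup_iff[OF group_SU sub_SU refl assms(6)]
      by blast
  qed
  assume "strongly_real ?G g"
  then obtain h where h: "h \<in> SU q \<eta>" "h ** g ** inv\<^bsub>?G\<^esub> h = inv\<^bsub>?G\<^esub> g" "h ** h = mat 1"
    unfolding strongly_real_subgroup_iff[OF group_SU sub_SU refl assms(6)] by blast
  define k where "k = inv\<^bsub>?G\<^esub> g"
  have gk: "g ** k = mat 1" "k ** g = mat 1"
    using G.r_inv[of g] G.l_inv[of g] assms(6) by (simp_all add: k_def matrix_monoid_def)
  have hg: "h ** g = k ** h"
  proof -
    have inv_h: "inv\<^bsub>?G\<^esub> h ** h = mat 1"
      using G.l_inv[of h] h(1) by (simp add: matrix_monoid_def)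
    have "h ** g ** (inv\<^bsub>?G\<^esub> h ** h) = (h ** g ** inv\<^bsub>?G\<^esub> h) ** h"
      by (simp add: matrix_mul_assoc)
    then show ?thesis unfolding h(2) inv_h by (simp add: k_def)
  qed
  have isom: "herm_form q \<eta> (a *v u) (a *v v) = herm_form q \<eta> u v" if "a \<in> SU q \<eta>" for a u v
    using that by (simp add: SU_def GU_def)
  interpret quadratic_field q "TYPE('a)"
    by unfold_locales (fact assms)+
  interpret hermitian_space q "herm_form q \<eta>"
  proof
    fix u v w :: "'a^'n" and c :: 'a
    show "herm_form q \<eta> u (v + w) = herm_form q \<eta> u v + herm_form q \<eta> u w"
      by (simp add: herm_form_def algebra_simps sum.distrib)
    show "herm_form q \<eta> u (c *s v) = c * herm_form q \<eta> u v"
      by (simp add: herm_form_def sum_distrib_left mult_ac)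
    have eta: "(\<eta> $ i $ j) ^ q = \<eta> $ j $ i" for i j
      using assms(4) by (auto simp: hermitian_matrix_def vec_eq_iff transpose_def frob_def)
    have "(herm_form q \<eta> u v) ^ q = (\<Sum>i\<in>UNIV. \<Sum>j\<in>UNIV. u $ i * \<eta> $ j $ i * (v $ j) ^ q)"
      by (simp add: herm_form_def power_q_sum[OF q] power_mult_distrib eta)
    also have "\<dots> = herm_form q \<eta> v u"
      unfolding herm_form_def by (subst sum.swap) (simp add: mult_ac)
    finally show "(herm_form q \<eta> u v) ^ q = herm_form q \<eta> v u" .
  next
    fix u :: "'a^'n" assume u: "\<And>v. herm_form q \<eta> u v = 0"
    \<comment> \<open>Pairing \<open>u\<close> with the standard basis gives the entries of the row
      vector \<open>?u v* \<eta>\<close>, and \<open>\<eta>\<close> is invertible.\<close>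
    let ?u = "\<chi> i. (u $ i) ^ q"
    have "herm_form q \<eta> u (axis j 1) = (?u v* \<eta>) $ j" for j
      by (simp add: herm_form_def vector_matrix_mult_def axis_def if_distrib mult.commute cong: if_cong)
    then have "?u v* \<eta> = 0" using u by (simp add: vec_eq_iff)
    moreover have "?u = (?u v* \<eta>) v* matrix_inv \<eta>"
      by (simp add: vector_matrix_mul_assoc matrix_inv_inverse[OF assms(5)])
    ultimately have "?u = 0" by (simp add: vector_matrix_mult_def vec_eq_iff)
    then show "u = 0" by (simp add: vec_eq_iff)
  qed
  interpret inverting_involution q "herm_form q \<eta>" "(*v) h" "(*v) g" "(*v) k"
  proof (intro inverting_involution.intro inverting_involution_axioms.intro hermitian_space_axioms)
    fix u v :: "'a^'n"
    show hh: "h *v (h *v v) = v" for v using h(3) by (simp add: matrix_vector_mul_assoc)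
    show gkv: "g *v (k *v v) = v" "k *v (g *v v) = v" for v
      using gk by (simp_all add: matrix_vector_mul_assoc)
    show "herm_form q \<eta> (h *v u) v = herm_form q \<eta> u (h *v v)"
      using isom[OF h(1), of u "h *v v"] by (simp add: hh)
    show "herm_form q \<eta> (g *v u) v = herm_form q \<eta> u (k *v v)"
      using isom[OF assms(6), of u "k *v v"] by (simp add: gkv)
    show "h *v (g *v v) = k *v (h *v v)"
      by (simp add: matrix_vector_mul_assoc hg)
  qed auto
  obtain W where W: "quadratic_Fq_subspace W" "(*v) h ` W \<subseteq> W" "(*v) g ` W \<subseteq> W" "vec.span W = UNIV"
    by (rule exists_spanning_quadratic_Fq_subspace)
  obtain B where B: "B \<subseteq> W" "vec.independent B" "W \<subseteq> vec.span B"
    using vec.basis_exists[of W] by metis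
  have spanB: "vec.span B = UNIV"
    using W(4) B(3) vec.span_minimal[OF B(3) vec.subspace_span] by auto
  have form: "orthogonal_Fq_form q \<eta> W"
    unfolding orthogonal_Fq_form_def
    using B(2) spanB span_Fq_eq[OF W(1) B(1) spanB] W(1)
    by (auto simp: quadratic_Fq_subspace_def)
  \<comment> \<open>An element of \<open>SU\<close> mapping the finite set \<open>W\<close> into
    itself maps it onto itself, being injective; nothing else separates it from the embedded group.
    This applies to \<open>g\<close> and to \<open>h\<close> alike.\<close>
  have SO: "a \<in> embedded_SO q \<eta> W" if a: "a \<in> SU q \<eta>" "(*v) a ` W \<subseteq> W" for a
  proof -
    have "invertible a" using a(1) by (simp add: SU_def GU_def)
    then have "inj ((*v) a)" by (simp add: invertible_left_inverse matrix_left_invertible_injective)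
    then have "(*v) a ` W = W" using endo_inj_surj[OF finite a(2)] inj_on_subset[OF _ subset_UNIV] by metis
    then show ?thesis using a(1) isom[OF a(1)] by (simp add: embedded_SO_def embedded_O_def SU_def)
  qed
  have g_SO: "g \<in> embedded_SO q \<eta> W" and h_SO: "h \<in> embedded_SO q \<eta> W"
    using SO assms(6) h(1) W(2,3) by auto
  have "strongly_real (matrix_monoid (embedded_SO q \<eta> W)) g"
    unfolding strongly_real_subgroup_iff[OF group_SU subgroup_embedded_SO[OF q form] refl g_SO]
    using h_SO h(2,3) by blast
  then show "\<exists>V\<^sub>0. orthogonal_Fq_form q \<eta> V\<^sub>0 \<and> g \<in> embedded_SO q \<eta> V\<^sub>0 \<and>
      strongly_real (matrix_monoid (embedded_SO q \<eta> V\<^sub>0)) g"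
    using form g_SO by blast
qed

end
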